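(* Consider the line arrangement in $\mathbb{P}^2=\mathbb{P}^2_{\mathbb{C}}$ $$\mathcal{A}^1_m: x(x^m-y^m)(y^m-z^m)(z^m-x^m)=0.$$ The line arrangement $\mathcal{A}^1_m$ is free, but not supersolvable, with exponents $(m+1,2m-1)$, and the corresponding dual set of points $Z$ admits unexpected curves of degree $j$ for $m\geq 4$ and any integer $j$ satisfying $$m+2\leq j\leq 2m-2.$$ The unexpected curves of minimal degree $j=m+2$ are all irreducible.
   Context: Work over $\mathbb{C}$, $S=\mathbb{C}[x,y,z]$; $m$ is a positive integer. For an arrangement $\mathcal{A}:f=0$ of $d$ distinct lines in $\mathbb{P}^2$, $AR(f)$ is the graded $S$-module of triples $(a,b,c)\in S^3$ with $af_x+bf_y+cf_z=0$. $\mathcal{A}$ is free with exponents $(d_1,d_2)$ if $AR(f)$ is a free graded $S$-module (of rank 2) with homogeneous generators of degrees $d_1,d_2$; then $d_1+d_2=d-1$. An intersection point $p$ of $\mathcal{A}$ is modular if for every other intersection point $p'$ of $\mathcal{A}$ the line $\overline{pp'}$ belongs to $\mathcal{A}$; $\mathcal{A}$ is supersolvable if it has a modular point. Unexpected curves: a finite set $Z\subset\mathbb{P}^2$ admits unexpected curves of degree $j\geq 2$ if, for a generic point $q\in\mathbb{P}^2$, $$h^0(\mathbb{P}^2,\mathcal{O}_{\mathbb{P}^2}(j)\otimes\mathcal{I}(Z+(j-1)q))>\max\left(0,\ h^0(\mathbb{P}^2,\mathcal{O}_{\mathbb{P}^2}(j)\otimes\mathcal{I}(Z))-\binom{j}{2}\right),$$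 where $\mathcal{I}(Z)$ is the ideal sheaf of functions vanishing on $Z$ and $\mathcal{I}(Z+(j-1)q)$ is the ideal sheaf of functions vanishing on $Z$ and vanishing to order $j-1$ at $q$. An unexpected curve of degree $j$ (for generic $q$) is then a curve $C_q$ of degree $j$ passing through all points of $Z$ and having multiplicity at least $j-1$ at $q$. Duality: a point $(a:b:c)\in\mathbb{P}^2$ is dual to the line $ax+by+cz=0$; the set dual to a line arrangement is the set of points dual to its lines.
   Formalization: "Not supersolvable" is proved for m ≥ 2 only: for m = 1 the arrangement x(x−y)(y−z)(z−x)=0 has the modular point (1:1:1) and is supersolvable. Freeness with exponents (m+1,2m−1) is proved for all m ≥ 1. *)

theory Defs
  imports
    "HOL-Computational_Algebra.Computational_Algebra"
    "HOL-Library.Product_Plus"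
begin

section \<open>The polynomial ring \<open>S\<close>\<close>

text \<open>
  \<open>S\<close> is rendered as the iterated polynomial ring \<open>\<complex>[x][y][z]\<close>: \<open>x\<close> is the innermost
  indeterminate and \<open>z\<close> the outermost one.
\<close>

type_synonym S = "complex poly poly poly"

definition X :: S where "X = [:[:[:0, 1:]:]:]"
definition Y :: S where "Y = [:[:0, 1:]:]"
definition Z :: S where "Z = [:0, 1:]"

definition const :: "complex \<Rightarrow> S" where "const t = [:[:[:t:]:]:]"

definition monom_coeff :: "S \<Rightarrow> nat \<Rightarrow> nat \<Rightarrow> nat \<Rightarrow> complex" where
  "monom_coeff f i j k = coeff (coeff (coeff f k) j) i"

fun eval :: "S \<Rightarrow> complex \<times> complex \<times> complex \<Rightarrow> complex" where
  "eval f (a, b, c) = poly (poly (poly f [:[:c:]:]) [:b:]) a"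

definition homogeneous :: "nat \<Rightarrow> S \<Rightarrow> bool" where
  "homogeneous d f \<longleftrightarrow> (\<forall>i j k. monom_coeff f i j k \<noteq> 0 \<longrightarrow> i + j + k = d)"

definition Dx :: "S \<Rightarrow> S" where "Dx = map_poly (map_poly pderiv)"
definition Dy :: "S \<Rightarrow> S" where "Dy = map_poly pderiv"
definition Dz :: "S \<Rightarrow> S" where "Dz = pderiv"

interpretation S_vs: vector_space "\<lambda>t f. const t * f"
proof
  have "const (s + t) = const s + const t" "const (s * t) = const s * const t" "const 1 = 1"
    for s t
    by (simp_all add: const_def one_pCons)
  then show "const t * (f + g) = const t * f + const t * g"
    "const (s + t) * f = const s * f + const t * f"
    "const s * (const t * f) = const (s * t) * f"
    "const 1 * f = f" for s t f g
    by (simp_all add: algebra_simps)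
qed


section \<open>The projective plane\<close>

fun scale3 :: "complex \<Rightarrow> complex \<times> complex \<times> complex \<Rightarrow> complex \<times> complex \<times> complex" where
  "scale3 t (a, b, c) = (t * a, t * b, t * c)"

fun dot3 :: "complex \<times> complex \<times> complex \<Rightarrow> complex \<times> complex \<times> complex \<Rightarrow> complex" where
  "dot3 (a, b, c) (u, v, w) = a * u + b * v + c * w"

definition proportional ::
  "((complex \<times> complex \<times> complex) \<times> (complex \<times> complex \<times> complex)) set" where
  "proportional = {(u, v). u \<noteq> 0 \<and> v \<noteq> 0 \<and> (\<exists>t. t \<noteq> 0 \<and> v = scale3 t u)}"

typedef proj2 = "(UNIV - {0}) // proportional"
  morphisms coords Proj2
  by (rule exI[of _ "proportional `` {(1, 0, 0)}"])
    (auto intro!: quotientI simp: zero_prod_def)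

text \<open>
  \<open>coords p\<close> is the set of all homogeneous coordinate vectors of \<open>p\<close>.  The conditions below are
  required of every coordinate vector; for homogeneous polynomials (and for linear forms) this is
  the same as requiring them of one.
\<close>

definition vanishes_at :: "S \<Rightarrow> proj2 \<Rightarrow> bool" where
  "vanishes_at f p \<longleftrightarrow> (\<forall>v \<in> coords p. eval f v = 0)"

definition vanishes_to_order :: "nat \<Rightarrow> S \<Rightarrow> proj2 \<Rightarrow> bool" where
  "vanishes_to_order r f p \<longleftrightarrow>
     (\<forall>i j k. i + j + k < r \<longrightarrow> vanishes_at ((Dx ^^ i) ((Dy ^^ j) ((Dz ^^ k) f))) p)"

definition dual_line :: "proj2 \<Rightarrow> proj2 set" where
  "dual_line p = {q. \<forall>u \<in> coords p. \<forall>v \<in> coords q. dot3 u v = 0}"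

definition zariski_closed :: "proj2 set \<Rightarrow> bool" where
  "zariski_closed W \<longleftrightarrow>
     (\<exists>F. (\<forall>f \<in> F. \<exists>d. homogeneous d f) \<and> W = {p. \<forall>f \<in> F. vanishes_at f p})"

text \<open>A property holds for a generic point if it holds on a nonempty Zariski open set.\<close>

definition generically :: "(proj2 \<Rightarrow> bool) \<Rightarrow> bool" where
  "generically P \<longleftrightarrow> (\<exists>W. zariski_closed W \<and> W \<noteq> UNIV \<and> (\<forall>q. q \<notin> W \<longrightarrow> P q))"


section \<open>Line arrangements\<close>

text \<open>
  The arrangement \<open>f = 0\<close>, for \<open>f\<close> a product of linear forms, as a set of lines.  Every line is
  \<open>dual_line l\<close> for a unique point \<open>l\<close>.
\<close>

definition arrangement :: "S \<Rightarrow> proj2 set set" where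
  "arrangement f = {L. (\<exists>l. L = dual_line l) \<and> (\<forall>p \<in> L. vanishes_at f p)}"

definition dual_points :: "proj2 set set \<Rightarrow> proj2 set" where
  "dual_points \<A> = {p. dual_line p \<in> \<A>}"

definition intersection_points :: "proj2 set set \<Rightarrow> proj2 set" where
  "intersection_points \<A> = {p. \<exists>L \<in> \<A>. \<exists>L' \<in> \<A>. L \<noteq> L' \<and> p \<in> L \<and> p \<in> L'}"

definition modular_point :: "proj2 set set \<Rightarrow> proj2 \<Rightarrow> bool" where
  "modular_point \<A> p \<longleftrightarrow> p \<in> intersection_points \<A> \<and>
     (\<forall>p' \<in> intersection_points \<A>. p' \<noteq> p \<longrightarrow> (\<exists>L \<in> \<A>. p \<in> L \<and> p' \<in> L))"

definition supersolvable :: "proj2 set set \<Rightarrow> bool" where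
  "supersolvable \<A> \<longleftrightarrow> (\<exists>p. modular_point \<A> p)"


section \<open>Jacobian syzygies and freeness\<close>

fun smult3 :: "S \<Rightarrow> S \<times> S \<times> S \<Rightarrow> S \<times> S \<times> S" where
  "smult3 s (a, b, c) = (s * a, s * b, s * c)"

interpretation S3: module smult3
  by unfold_locales (auto simp: algebra_simps)

definition AR :: "S \<Rightarrow> (S \<times> S \<times> S) set" where
  "AR f = {(a, b, c). a * Dx f + b * Dy f + c * Dz f = 0}"

fun homogeneous3 :: "nat \<Rightarrow> S \<times> S \<times> S \<Rightarrow> bool" where
  "homogeneous3 d (a, b, c) \<longleftrightarrow> homogeneous d a \<and> homogeneous d b \<and> homogeneous d c"

definition free_with_exponents :: "S \<Rightarrow> nat \<Rightarrow> nat \<Rightarrow> bool" where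
  "free_with_exponents f d1 d2 \<longleftrightarrow>
     (\<exists>r1 r2. r1 \<noteq> r2 \<and> homogeneous3 d1 r1 \<and> homogeneous3 d2 r2 \<and>
        S3.independent {r1, r2} \<and> S3.span {r1, r2} = AR f)"


section \<open>Unexpected curves\<close>

text \<open>
  The global sections of \<open>\<O>(j) \<otimes> \<I>(A)\<close> and of \<open>\<O>(j) \<otimes> \<I>(A + r q)\<close>, as spaces of forms of
  degree \<open>j\<close> (with the zero form).
\<close>

definition forms_through :: "proj2 set \<Rightarrow> nat \<Rightarrow> S set" where
  "forms_through A j = {F. homogeneous j F \<and> (\<forall>p \<in> A. vanishes_at F p)}"

definition forms_through_mult :: "proj2 set \<Rightarrow> nat \<Rightarrow> nat \<Rightarrow> proj2 \<Rightarrow> S set" where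
  "forms_through_mult A j r q = {F \<in> forms_through A j. vanishes_to_order r F q}"

definition admits_unexpected_curves :: "proj2 set \<Rightarrow> nat \<Rightarrow> bool" where
  "admits_unexpected_curves A j \<longleftrightarrow> finite A \<and> j \<ge> 2 \<and>
     generically (\<lambda>q. int (S_vs.dim (forms_through_mult A j (j - 1) q)) >
       max 0 (int (S_vs.dim (forms_through A j)) - int (j choose 2)))"

text \<open>
  \<open>F = 0\<close> is a curve \<open>C\<^sub>q\<close> of degree \<open>j\<close> through \<open>A\<close> with multiplicity at least \<open>j - 1\<close> at \<open>q\<close>.
  It is an unexpected curve when \<open>A\<close> admits unexpected curves of degree \<open>j\<close> and \<open>q\<close> is generic.
\<close>

definition curve_Cq :: "proj2 set \<Rightarrow> nat \<Rightarrow> proj2 \<Rightarrow> S \<Rightarrow> bool" where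
  "curve_Cq A j q F \<longleftrightarrow> F \<noteq> 0 \<and> F \<in> forms_through_mult A j (j - 1) q"


section \<open>The arrangement \<open>x (x\<^sup>m - y\<^sup>m) (y\<^sup>m - z\<^sup>m) (z\<^sup>m - x\<^sup>m) = 0\<close>\<close>

definition f1 :: "nat \<Rightarrow> S" where
  "f1 m = X * (X ^ m - Y ^ m) * (Y ^ m - Z ^ m) * (Z ^ m - X ^ m)"

definition A1 :: "nat \<Rightarrow> proj2 set set" where
  "A1 m = arrangement (f1 m)"

end

(* The derivation theta = (x^(m+1), y^(m+1), z^(m+1)) is tangent to all lines of the arrangement.
   Together with x * ((yz)^(m-1), (xz)^(m-1), (xy)^(m-1)) and the Euler derivation it has
   determinant f, so Saito's criterion gives freeness; subtracting multiples of the Euler derivation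
   turns the two derivations into syzygies of degrees m+1 and 2m-1.

   For q in the dual plane, F_q(p) = p . theta(p x q) has degree m+2, multiplicity m+1 at q, and
   vanishes on Z because theta is tangent to the lines dual to Z. Multiplying F_q by j-m-2 lines
   through q gives j-m-1 independent forms, which beats the expected number because Z imposes
   independent conditions in degree j.

   A form of degree d with multiplicity d-1 at q is affine along the lines through q. Eliminating the
   affine coordinate between such a form h (with d <= m+1) and F_q yields a binary form of degree
   d+m+1; if h vanishes at more than d+m+1 points of Z this form is zero. For generic q the two
   coefficients of F_q are coprime, which then forces h = 0. This bounds the degree of unexpected
   curves from below. It also gives irreducibility in degree m+2: a proper factorization has a factor
   consisting of lines through q, and the cofactor would still contain too many points of Z. *)

theory Submission
  imports Defs "HOL-Computational_Algebra.Field_as_Ring"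
begin

section \<open>Evaluation, partial derivatives and homogeneity\<close>

text \<open>The two ends of the degree range have separate causes. Multiplying F_q by products of
  lines through q gives j - m - 1 forms, hence none below j = m + 2. The 3m + 1 points of Z cut the
  forms of degree j down to dimension at most binom(j+2,2) - (3m+1), so the expected number is at
  most max(0, 2j - 3m), which catches up with j - m - 1 at j = 2m - 1.

  Multiplicity d - 1 at q is a condition on many partial derivatives at one point. For forms of
  degree d it implies the single identity that the second derivative in the direction q vanishes
  everywhere; the lower bound on degrees and the irreducibility use it in this shape.

  Coprimality has a geometric meaning: F_q and its derivative in the direction q are p . theta(v)
  and q . theta(v) with v = p x q, so a common zero makes theta(v) proportional to v. Only finitely
  many points v of the plane have this property, and the dual line of a generic q misses them.
  Genericity thereby becomes avoidance of finitely many explicit lines.\<close>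

lemma S_induct [case_names const X Y Z add mult]:
  assumes const: "\<And>t. P (const t)"
    and gens: "P X" "P Y" "P Z"
    and add: "\<And>f g. P f \<Longrightarrow> P g \<Longrightarrow> P (f + g)"
    and mult: "\<And>f g. P f \<Longrightarrow> P g \<Longrightarrow> P (f * g)"
  shows "P f"
proof -
  have zero: "P 0"
    using const[of 0] by (simp add: const_def)
  have x: "P [:[:p:]:]" for p
  proof (induction p)
    case (pCons a p)
    have "[:[:pCons a p:]:] = const a + X * [:[:p:]:]"
      by (simp add: const_def X_def)
    then show ?case
      using pCons const gens add mult by metis
  qed (use zero in simp)
  have y: "P [:q:]" for q
  proof (induction q)
    case (pCons a q)
    have "[:pCons a q:] = [:[:a:]:] + Y * [:q:]"
      by (simp add: Y_def)
    then show ?case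
      using pCons x gens add mult by metis
  qed (use zero in simp)
  show ?thesis
  proof (induction f)
    case (pCons a f)
    have "pCons a f = [:a:] + Z * f"
      by (simp add: Z_def)
    then show ?case
      using pCons y gens add mult by metis
  qed (use zero in simp)
qed

lemma eval_simps [simp]:
  "eval (f + g) v = eval f v + eval g v"
  "eval (f - g) v = eval f v - eval g v"
  "eval (- f) v = - eval f v"
  "eval (f * g) v = eval f v * eval g v"
  "eval (f ^ n) v = eval f v ^ n"
  "eval (const t) v = t"
  "eval 0 v = 0"
  "eval 1 v = 1"
  "eval X (x, y, z) = x"
  "eval Y (x, y, z) = y"
  "eval Z (x, y, z) = z"
  by (cases v; simp add: const_def X_def Y_def Z_def)+

declare eval.simps [simp del]

lemma eval_of_nat [simp]: "eval (of_nat n) v = of_nat n"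
  by (induction n) auto

lemma eval_sum [simp]: "eval (sum f I) v = (\<Sum>i\<in>I. eval (f i) v)"
  by (induction I rule: infinite_finite_induct) auto

lemma eval_prod [simp]: "eval (prod f I) v = (\<Prod>i\<in>I. eval (f i) v)"
  by (induction I rule: infinite_finite_induct) auto

lemma poly_zero_on_consts:
  fixes f :: "'a :: {idom, ring_char_0} poly poly"
  assumes "\<And>b. poly f [:b:] = 0"
  shows "f = 0"
proof (rule ccontr)
  assume "f \<noteq> 0"
  then have "finite {x. poly f x = 0}"
    by (rule poly_roots_finite)
  then have "finite (range (\<lambda>b::'a. [:b:]))"
    by (rule rev_finite_subset) (use assms in auto)
  then have "finite (UNIV :: 'a set)"
    by (rule finite_imageD) (auto simp: inj_on_def)
  then show False
    by (simp add: infinite_UNIV_char_0)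
qed

text \<open>Since the complex numbers are infinite, the variables can be removed one at a time.
  Identities in \<open>S\<close> can then be verified by evaluation.\<close>

lemma eval_ext:
  assumes "\<And>v. eval f v = eval g v"
  shows "f = g"
proof -
  let ?h = "f - g"
  have h: "eval ?h v = 0" for v
    using assms by simp
  have "poly (poly (poly ?h [:[:c:]:]) [:b:]) a = 0" for a b c
    using h[of "(a, b, c)"] by (simp only: eval.simps)
  then have "poly (poly ?h [:[:c:]:]) [:b:] = 0" for b c
    by (metis poly_all_0_iff_0)
  then have *: "poly ?h [:[:c:]:] = 0" for c
    by (rule poly_zero_on_consts)
  have "?h = 0"
  proof (rule ccontr)
    assume "?h \<noteq> 0"
    then have "finite {x. poly ?h x = 0}"
      by (rule poly_roots_finite)
    then have "finite (range (\<lambda>c::complex. [:[:c:]:]))"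
      by (rule rev_finite_subset) (use * in auto)
    then have "finite (UNIV :: complex set)"
      by (rule finite_imageD) (auto simp: inj_on_def)
    then show False
      by (simp add: infinite_UNIV_char_0)
  qed
  then show ?thesis by simp
qed

lemma eval_nonzero: "f \<noteq> 0 \<Longrightarrow> \<exists>v. eval f v \<noteq> 0"
  using eval_ext[of f 0] by auto

lemma const_simps [simp]:
  "const 0 = 0" "const 1 = 1" "const (s + t) = const s + const t"
  "const (s * t) = const s * const t" "const (s - t) = const s - const t" "const (- t) = - const t"
  "const (t ^ n) = const t ^ n" "const s = const t \<longleftrightarrow> s = t" "const t = 0 \<longleftrightarrow> t = 0"
proof -
  show "const (t ^ n) = const t ^ n" by (rule eval_ext) simp
qed (auto simp: const_def one_pCons)

lemma const_of_nat: "const (of_nat n) = of_nat n"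
  by (rule eval_ext) simp

lemma map_poly_derivation:
  fixes D :: "'a::comm_ring_1 \<Rightarrow> 'a"
  assumes add: "\<And>a b. D (a + b) = D a + D b" and mult: "\<And>a b. D (a * b) = D a * b + a * D b"
  shows "map_poly D (f + g) = map_poly D f + map_poly D g"
    and "map_poly D (f * g) = map_poly D f * g + f * map_poly D g"
proof -
  have zero: "D 0 = 0"
    using add[of 0 0] by simp
  have sum: "D (sum h I) = (\<Sum>i\<in>I. D (h i))" for h :: "nat \<Rightarrow> 'a" and I
    by (induction I rule: infinite_finite_induct) (auto simp: add zero)
  show "map_poly D (f + g) = map_poly D f + map_poly D g"
    by (rule poly_eqI) (simp add: coeff_map_poly zero add)
  show "map_poly D (f * g) = map_poly D f * g + f * map_poly D g"
    by (rule poly_eqI) (simp add: coeff_map_poly zero coeff_mult sum mult sum.distrib)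
qed

lemma D_add [simp]:
  "Dx (f + g) = Dx f + Dx g" "Dy (f + g) = Dy f + Dy g" "Dz (f + g) = Dz f + Dz g"
  unfolding Dx_def Dy_def Dz_def
  by (intro map_poly_derivation; simp add: pderiv_add pderiv_mult map_poly_derivation algebra_simps)+
    (simp add: pderiv_add)

lemma D_mult:
  "Dx (f * g) = Dx f * g + f * Dx g" "Dy (f * g) = Dy f * g + f * Dy g"
  "Dz (f * g) = Dz f * g + f * Dz g"
  unfolding Dx_def Dy_def Dz_def
  by (intro map_poly_derivation; simp add: pderiv_add pderiv_mult map_poly_derivation algebra_simps)+
    (simp add: pderiv_mult)

lemma D_gens [simp]:
  "Dx (const t) = 0" "Dy (const t) = 0" "Dz (const t) = 0"
  "Dx X = 1" "Dy X = 0" "Dz X = 0"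
  "Dx Y = 0" "Dy Y = 1" "Dz Y = 0"
  "Dx Z = 0" "Dy Z = 0" "Dz Z = 1"
  by (simp_all add: Dx_def Dy_def Dz_def const_def X_def Y_def Z_def map_poly_pCons pderiv_pCons one_pCons)

lemma D_0 [simp]: "Dx 0 = 0" "Dy 0 = 0" "Dz 0 = 0"
  by (simp_all add: Dx_def Dy_def Dz_def)

lemma D_commute: "Dx (Dy f) = Dy (Dx f)" "Dx (Dz f) = Dz (Dx f)" "Dy (Dz f) = Dz (Dy f)"
proof -
  have "Dx (Dy f) = Dy (Dx f) \<and> Dx (Dz f) = Dz (Dx f) \<and> Dy (Dz f) = Dz (Dy f)"
    using D_gens(1)[of 1] D_gens(2)[of 1] D_gens(3)[of 1]
    by (induction f rule: S_induct) (auto simp: D_mult algebra_simps)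
  then show "Dx (Dy f) = Dy (Dx f)" "Dx (Dz f) = Dz (Dx f)" "Dy (Dz f) = Dz (Dy f)" by auto
qed

lemma D_minus [simp]:
  "Dx (f - g) = Dx f - Dx g" "Dy (f - g) = Dy f - Dy g" "Dz (f - g) = Dz f - Dz g"
  using D_add(1)[of "f - g" g] D_add(2)[of "f - g" g] D_add(3)[of "f - g" g] by simp_all

lemma D_1 [simp]: "Dx 1 = 0" "Dy 1 = 0" "Dz 1 = 0"
  using D_gens(1)[of 1] D_gens(2)[of 1] D_gens(3)[of 1] by simp_all

lemma D_power:
  "Dx (f ^ n) = of_nat n * f ^ (n - 1) * Dx f"
  "Dy (f ^ n) = of_nat n * f ^ (n - 1) * Dy f"
  "Dz (f ^ n) = of_nat n * f ^ (n - 1) * Dz f"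
proof -
  have "Dx (f ^ n) = of_nat n * f ^ (n - 1) * Dx f \<and>
    Dy (f ^ n) = of_nat n * f ^ (n - 1) * Dy f \<and> Dz (f ^ n) = of_nat n * f ^ (n - 1) * Dz f"
  proof (induction n)
    case (Suc n)
    then show ?case
      by (cases n) (auto simp: D_mult algebra_simps)
  qed simp
  then show "Dx (f ^ n) = of_nat n * f ^ (n - 1) * Dx f"
    "Dy (f ^ n) = of_nat n * f ^ (n - 1) * Dy f" "Dz (f ^ n) = of_nat n * f ^ (n - 1) * Dz f" by auto
qed

lemma homogeneous_0 [simp]: "homogeneous d 0"
  by (simp add: homogeneous_def monom_coeff_def)

lemma homogeneous_add: "homogeneous d f \<Longrightarrow> homogeneous d g \<Longrightarrow> homogeneous d (f + g)"
  unfolding homogeneous_def monom_coeff_def by (metis add.right_neutral coeff_add)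

lemma homogeneous_sum: "(\<And>i. i \<in> I \<Longrightarrow> homogeneous d (f i)) \<Longrightarrow> homogeneous d (sum f I)"
  by (induction I rule: infinite_finite_induct) (auto intro: homogeneous_add)

lemma homogeneous_const [simp]: "homogeneous 0 (const t)"
  by (auto simp: homogeneous_def monom_coeff_def const_def coeff_pCons split: nat.splits)

lemma homogeneous_gens [simp]: "homogeneous (Suc 0) X" "homogeneous (Suc 0) Y" "homogeneous (Suc 0) Z"
  by (auto simp: homogeneous_def monom_coeff_def X_def Y_def Z_def one_pCons coeff_pCons split: nat.splits)

lemma homogeneous_mult:
  assumes f: "homogeneous d f" and g: "homogeneous e g"
  shows "homogeneous (d + e) (f * g)"
  unfolding homogeneous_def
proof (intro allI impI)
  fix i j k
  assume "monom_coeff (f * g) i j k \<noteq> 0"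
  then have "(\<Sum>c\<le>k. \<Sum>b\<le>j. \<Sum>a\<le>i. monom_coeff f a b c * monom_coeff g (i - a) (j - b) (k - c)) \<noteq> 0"
    by (simp add: monom_coeff_def coeff_mult coeff_sum)
  then obtain a b c where abc: "a \<le> i" "b \<le> j" "c \<le> k"
    and nz: "monom_coeff f a b c * monom_coeff g (i - a) (j - b) (k - c) \<noteq> 0"
    by (metis (no_types, lifting) atMost_iff sum.neutral)
  then have "monom_coeff f a b c \<noteq> 0" "monom_coeff g (i - a) (j - b) (k - c) \<noteq> 0"
    by auto
  then have "a + b + c = d" "(i - a) + (j - b) + (k - c) = e"
    using f g unfolding homogeneous_def by blast+
  then show "i + j + k = d + e"
    using abc by linarith
qed

lemma homogeneous_power: "homogeneous d f \<Longrightarrow> homogeneous (n * d) (f ^ n)"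
  by (induction n) (auto intro: homogeneous_mult simp: homogeneous_const[of 1, simplified])

lemma homogeneous_const_mult: "homogeneous d f \<Longrightarrow> homogeneous d (const t * f)"
  using homogeneous_mult[OF homogeneous_const] by simp

lemma homogeneous_uminus: "homogeneous d f \<Longrightarrow> homogeneous d (- f)"
  using homogeneous_const_mult[of d f "-1"] by simp

lemma homogeneous_diff: "homogeneous d f \<Longrightarrow> homogeneous d g \<Longrightarrow> homogeneous d (f - g)"
  using homogeneous_add[of d f "- g"] homogeneous_uminus by simp

lemma homogeneous_prod:
  "(\<And>i. i \<in> I \<Longrightarrow> homogeneous (d i) (f i)) \<Longrightarrow> homogeneous (sum d I) (prod f I)"
  by (induction I rule: infinite_finite_induct)
    (auto intro: homogeneous_mult simp: homogeneous_const[of 1, simplified])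

lemma homogeneous_power1: "homogeneous (Suc 0) f \<Longrightarrow> homogeneous n (f ^ n)"
  using homogeneous_power[of "Suc 0" f n] by simp

lemma homogeneous_D:
  assumes "homogeneous d f"
  shows "homogeneous (d - 1) (Dx f)" "homogeneous (d - 1) (Dy f)" "homogeneous (d - 1) (Dz f)"
proof -
  have "monom_coeff (Dx f) i j k = of_nat (Suc i) * monom_coeff f (Suc i) j k"
    "monom_coeff (Dy f) i j k = of_nat (Suc j) * monom_coeff f i (Suc j) k"
    "monom_coeff (Dz f) i j k = of_nat (Suc k) * monom_coeff f i j (Suc k)" for i j k
    by (simp_all add: monom_coeff_def Dx_def Dy_def Dz_def coeff_map_poly coeff_pderiv of_nat_poly del: of_nat_Suc)
  then show "homogeneous (d - 1) (Dx f)" "homogeneous (d - 1) (Dy f)" "homogeneous (d - 1) (Dz f)"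
    using assms unfolding homogeneous_def
    by (metis (no_types) add_Suc add_Suc_right diff_Suc_1 mult_zero_right)+
qed

section \<open>The monomial basis of the forms of fixed degree\<close>

text \<open>The exponent of \<open>Z\<close> is forced by the degree, so pairs suffice as indices;
  on \<open>mono_index d\<close> the truncated subtraction is exact.\<close>

definition mono3 :: "nat \<Rightarrow> nat \<times> nat \<Rightarrow> S" where
  "mono3 d = (\<lambda>(a, b). X ^ a * Y ^ b * Z ^ (d - a - b))"

definition mono_index :: "nat \<Rightarrow> (nat \<times> nat) set" where
  "mono_index d = (SIGMA a:{..d}. {..d - a})"

lemma monom_coeff_monom:
  "monom_coeff (X ^ a * Y ^ b * Z ^ c) i j k = (if i = a \<and> j = b \<and> k = c then 1 else 0)"
proof -
  have 1: "X ^ a = [:[:monom 1 a:]:]"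
    by (induction a) (auto simp: X_def monom_Suc monom_0 mult.commute simp flip: one_pCons)
  have 2: "Y ^ b = [:monom 1 b:]"
    by (induction b) (auto simp: Y_def monom_Suc monom_0 mult.commute simp flip: one_pCons)
  have 3: "Z ^ c = monom 1 c"
    by (induction c) (auto simp: Z_def monom_Suc monom_0 mult.commute simp flip: one_pCons)
  have "X ^ a * Y ^ b * Z ^ c = monom (monom (monom 1 a) b) c"
    unfolding 1 2 3 by (simp add: smult_monom mult.commute)
  then show ?thesis
    by (auto simp: monom_coeff_def)
qed

lemma monom_coeff_ext: "(\<And>i j k. monom_coeff f i j k = monom_coeff g i j k) \<Longrightarrow> f = g"
  unfolding monom_coeff_def by (meson poly_eqI)

lemma monom_coeff_sum: "monom_coeff (sum f I) i j k = (\<Sum>a\<in>I. monom_coeff (f a) i j k)"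
  by (simp add: monom_coeff_def coeff_sum)

lemma monom_coeff_const_mult: "monom_coeff (const t * f) i j k = t * monom_coeff f i j k"
  by (simp add: monom_coeff_def const_def)

lemma finite_mono_index [simp]: "finite (mono_index d)"
  by (simp add: mono_index_def)

lemma homogeneous_expand:
  assumes "homogeneous d f"
  shows "f = (\<Sum>(a, b)\<in>mono_index d. const (monom_coeff f a b (d - a - b)) * mono3 d (a, b))"
proof (rule monom_coeff_ext)
  fix i j k
  have "monom_coeff (\<Sum>(a, b)\<in>mono_index d. const (monom_coeff f a b (d - a - b)) * mono3 d (a, b)) i j k
    = (\<Sum>p\<in>mono_index d. if p = (i, j) \<and> k = d - i - j then monom_coeff f i j k else 0)"
    unfolding monom_coeff_sum
    by (rule sum.cong) (auto simp: monom_coeff_const_mult mono3_def monom_coeff_monom split: if_splits)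
  also have "\<dots> = (if (i, j) \<in> mono_index d \<and> k = d - i - j then monom_coeff f i j k else 0)"
    by (cases "k = d - i - j") (auto simp: sum.delta)
  also have "\<dots> = monom_coeff f i j k"
    using assms unfolding homogeneous_def mono_index_def by force
  finally show "monom_coeff f i j k = monom_coeff
    (\<Sum>(a, b)\<in>mono_index d. const (monom_coeff f a b (d - a - b)) * mono3 d (a, b)) i j k" by simp
qed

lemma card_mono_index: "card (mono_index d) = (d + 2) choose 2"
proof -
  have "card (mono_index d) = (\<Sum>a\<le>d. Suc (d - a))"
    by (simp add: mono_index_def)
  also have "\<dots> = (\<Sum>a\<le>d. Suc a)"
    by (rule sum.reindex_bij_witness[of _ "\<lambda>a. d - a" "\<lambda>a. d - a"]) auto
  also have "\<dots> = (d + 2) choose 2"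
    by (induction d) (auto simp: numeral_2_eq_2)
  finally show ?thesis .
qed

lemma homogeneous_eval_scale:
  assumes "homogeneous d f"
  shows "eval f (scale3 t v) = t ^ d * eval f v"
proof -
  obtain x y z where v: "v = (x, y, z)" by (cases v)
  have "eval (mono3 d p) (t * x, t * y, t * z) = t ^ d * eval (mono3 d p) (x, y, z)" if "p \<in> mono_index d" for p
  proof -
    obtain a b where p: "p = (a, b)"
      by (cases p)
    have ab: "a + b \<le> d"
      using that by (auto simp: p mono_index_def)
    have "t ^ d = t ^ a * t ^ b * t ^ (d - a - b)"
      using ab by (simp flip: power_add)
    then show ?thesis
      by (simp add: p mono3_def power_mult_distrib)
  qed
  then have "eval (\<Sum>(a, b)\<in>mono_index d. const (monom_coeff f a b (d - a - b)) * mono3 d (a, b)) (scale3 t v)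
    = t ^ d * eval (\<Sum>(a, b)\<in>mono_index d. const (monom_coeff f a b (d - a - b)) * mono3 d (a, b)) v"
    by (auto simp: v sum_distrib_left split_beta algebra_simps intro!: sum.cong)
  then show ?thesis
    unfolding homogeneous_expand[OF assms, symmetric] .
qed

section \<open>Linear forms and expansions along lines\<close>

definition linf :: "complex \<times> complex \<times> complex \<Rightarrow> S" where
  "linf = (\<lambda>(a, b, c). const a * X + const b * Y + const c * Z)"

definition dir_deriv :: "complex \<times> complex \<times> complex \<Rightarrow> S \<Rightarrow> S" where
  "dir_deriv = (\<lambda>(a, b, c) f. const a * Dx f + const b * Dy f + const c * Dz f)"

fun cross3 :: "complex \<times> complex \<times> complex \<Rightarrow> complex \<times> complex \<times> complex \<Rightarrow> complex \<times> complex \<times> complex" where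
  "cross3 (a, b, c) (u, v, w) = (b * w - c * v, c * u - a * w, a * v - b * u)"

lemma eval_linf [simp]: "eval (linf c) v = dot3 c v"
  by (cases c; cases v) (simp add: linf_def)

lemma homogeneous_linf [simp]: "homogeneous (Suc 0) (linf c)"
  by (cases c) (auto simp: linf_def intro!: homogeneous_add homogeneous_const_mult)

lemma D_linf [simp]:
  "Dx (linf (a, b, c)) = const a" "Dy (linf (a, b, c)) = const b" "Dz (linf (a, b, c)) = const c"
  by (simp_all add: linf_def D_mult)

lemma linf_eq_0_iff [simp]: "linf c = 0 \<longleftrightarrow> c = 0"
proof (cases c)
  case (fields x y z)
  have "x = 0 \<and> y = 0 \<and> z = 0" if "linf c = 0"
  proof -
    have "dot3 c v = 0" for v
      using eval_linf[of c v] that by simp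
    from this[of "(1, 0, 0)"] this[of "(0, 1, 0)"] this[of "(0, 0, 1)"] show ?thesis
      by (simp add: fields)
  qed
  then show ?thesis
    by (auto simp: fields linf_def zero_prod_def)
qed

text \<open>All conditions on \<open>w\<close> together say that one nonzero product does not vanish
  at \<open>w\<close>; the extra factor \<open>X\<close> in it forces \<open>w\<close> to be
  nonzero.\<close>

lemma avoid_lines_and_form:
  assumes "finite C" "0 \<notin> C" "f \<noteq> 0"
  shows "\<exists>w. w \<noteq> 0 \<and> eval f w \<noteq> 0 \<and> (\<forall>c\<in>C. dot3 c w \<noteq> 0)"
proof -
  have "X * f * (\<Prod>c\<in>C. linf c) \<noteq> 0"
    using assms by (auto simp: X_def)
  then obtain w where "eval (X * f * (\<Prod>c\<in>C. linf c)) w \<noteq> 0"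
    using eval_nonzero by blast
  then show ?thesis
    using assms(1) by (intro exI[of _ w]) (cases w; auto simp: zero_prod_def)
qed

lemma avoid_lines:
  assumes "finite C" "0 \<notin> C"
  shows "\<exists>w. w \<noteq> 0 \<and> (\<forall>c\<in>C. dot3 c w \<noteq> 0)"
  using avoid_lines_and_form[OF assms, of 1] by auto

lemma dir_deriv_add: "dir_deriv q (f + g) = dir_deriv q f + dir_deriv q g"
  by (cases q) (simp add: dir_deriv_def algebra_simps)

lemma dir_deriv_mult: "dir_deriv q (f * g) = dir_deriv q f * g + f * dir_deriv q g"
  by (cases q) (simp add: dir_deriv_def D_mult algebra_simps)

lemma homogeneous_dir_deriv: "homogeneous d f \<Longrightarrow> homogeneous (d - 1) (dir_deriv q f)"
  by (cases q) (auto simp: dir_deriv_def intro!: homogeneous_add homogeneous_const_mult homogeneous_D[simplified])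

section \<open>Restriction to parametrized lines\<close>

text \<open>Value and derivative go through the induction together, because the product rule refers
  to the values of both factors.\<close>

lemma line_poly_exists:
  "\<exists>p. (\<forall>s. poly p s = eval f (u + scale3 s w)) \<and>
       (\<forall>s. poly (pderiv p) s = eval (dir_deriv w f) (u + scale3 s w))"
proof -
  obtain a b c where u: "u = (a, b, c)" by (cases u)
  obtain a' b' c' where w: "w = (a', b', c')" by (cases w)
  show ?thesis
  proof (induction f rule: S_induct)
    case (const t)
    show ?case by (intro exI[of _ "[:t:]"]) (auto simp: w dir_deriv_def pderiv_pCons)
  next
    case X
    show ?case by (intro exI[of _ "[:a, a':]"]) (auto simp: u w dir_deriv_def pderiv_pCons)
  next
    case Y
    show ?case by (intro exI[of _ "[:b, b':]"]) (auto simp: u w dir_deriv_def pderiv_pCons)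
  next
    case Z
    show ?case by (intro exI[of _ "[:c, c':]"]) (auto simp: u w dir_deriv_def pderiv_pCons)
  next
    case (add f g)
    then obtain p q where
      "\<forall>s. poly p s = eval f (u + scale3 s w)" "\<forall>s. poly (pderiv p) s = eval (dir_deriv w f) (u + scale3 s w)"
      "\<forall>s. poly q s = eval g (u + scale3 s w)" "\<forall>s. poly (pderiv q) s = eval (dir_deriv w g) (u + scale3 s w)"
      by blast
    then show ?case by (intro exI[of _ "p + q"]) (auto simp: dir_deriv_add pderiv_add)
  next
    case (mult f g)
    then obtain p q where
      "\<forall>s. poly p s = eval f (u + scale3 s w)" "\<forall>s. poly (pderiv p) s = eval (dir_deriv w f) (u + scale3 s w)"
      "\<forall>s. poly q s = eval g (u + scale3 s w)" "\<forall>s. poly (pderiv q) s = eval (dir_deriv w g) (u + scale3 s w)"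
      by blast
    then show ?case by (intro exI[of _ "p * q"]) (auto simp: dir_deriv_mult pderiv_mult)
  qed
qed

text \<open>A complex polynomial is determined by its values, so the restriction can be specified
  pointwise, without a substitution map on nested polynomials.\<close>

definition line_poly :: "complex \<times> complex \<times> complex \<Rightarrow> complex \<times> complex \<times> complex \<Rightarrow> S \<Rightarrow> complex poly" where
  "line_poly u w f = (THE p. \<forall>s. poly p s = eval f (u + scale3 s w))"

lemma line_poly_eqI: "(\<And>s. poly p s = eval f (u + scale3 s w)) \<Longrightarrow> line_poly u w f = p"
  unfolding line_poly_def by (rule the_equality) (auto simp flip: poly_eq_poly_eq_iff)

lemma poly_line_poly [simp]: "poly (line_poly u w f) s = eval f (u + scale3 s w)"
  using line_poly_exists[of f u w] line_poly_eqI by metis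

lemma pderiv_line_poly: "pderiv (line_poly u w f) = line_poly u w (dir_deriv w f)"
  using line_poly_exists[of f u w] line_poly_eqI by metis

lemma line_poly_mult [simp]: "line_poly u w (f * g) = line_poly u w f * line_poly u w g"
  and line_poly_add [simp]: "line_poly u w (f + g) = line_poly u w f + line_poly u w g"
  and line_poly_const [simp]: "line_poly u w (const t) = [:t:]"
  and line_poly_0 [simp]: "line_poly u w 0 = 0"
  by (rule line_poly_eqI; simp)+

lemma line_poly_power [simp]: "line_poly u w (f ^ n) = line_poly u w f ^ n"
  by (rule line_poly_eqI) (simp add: poly_power)

lemma line_poly_sum [simp]: "line_poly u w (sum f I) = (\<Sum>i\<in>I. line_poly u w (f i))"
  by (rule line_poly_eqI) (simp add: poly_sum)

lemma degree_line_poly_le: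
  assumes "homogeneous d f"
  shows "degree (line_poly u w f) \<le> d"
proof -
  obtain a b c where u: "u = (a, b, c)" by (cases u)
  obtain a' b' c' where w: "w = (a', b', c')" by (cases w)
  have gens: "line_poly u w X = [:a, a':]" "line_poly u w Y = [:b, b':]" "line_poly u w Z = [:c, c':]"
    by (rule line_poly_eqI; simp add: u w)+
  have pw: "degree ([:x, y:] ^ n) \<le> n" for x y :: complex and n
  proof -
    have "degree [:x, y:] * n \<le> 1 * n"
      by (rule mult_right_mono) auto
    then show ?thesis
      using degree_power_le[of "[:x, y:]" n] by linarith
  qed
  have "degree (line_poly u w (mono3 d p)) \<le> d" if "p \<in> mono_index d" for p
  proof -
    obtain i j where p: "p = (i, j)"
      by (cases p)
    have ij: "i + j \<le> d"
      using that by (auto simp: p mono_index_def)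
    have "degree (line_poly u w (mono3 d p)) \<le> i + j + (d - i - j)"
      unfolding p mono3_def prod.case line_poly_mult line_poly_power gens
      by (intro order_trans[OF degree_mult_le] add_mono pw)
    then show ?thesis using ij by simp
  qed
  then have "degree (line_poly u w (\<Sum>(a, b)\<in>mono_index d. const (monom_coeff f a b (d - a - b)) * mono3 d (a, b))) \<le> d"
    unfolding line_poly_sum by (intro degree_sum_le) (auto intro!: order_trans[OF degree_smult_le])
  then show ?thesis
    unfolding homogeneous_expand[OF assms, symmetric] .
qed

section \<open>Order of vanishing at a vector\<close>

text \<open>A recursive version of \<open>vanishes_to_order\<close> at a single coordinate vector,
  so that arguments by the product rule become inductions on the order.\<close>

fun vanish_order :: "nat \<Rightarrow> S \<Rightarrow> complex \<times> complex \<times> complex \<Rightarrow> bool" where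
  "vanish_order 0 f q \<longleftrightarrow> True"
| "vanish_order (Suc r) f q \<longleftrightarrow> eval f q = 0 \<and> vanish_order r (Dx f) q \<and> vanish_order r (Dy f) q \<and> vanish_order r (Dz f) q"

text \<open>The recursion takes the partial derivatives in any order, the closed form only in a
  sorted one; \<open>D_commute\<close> reconciles the two.\<close>

lemma vanish_order_iff: "vanish_order r f q \<longleftrightarrow> (\<forall>i j k. i + j + k < r \<longrightarrow> eval ((Dx ^^ i) ((Dy ^^ j) ((Dz ^^ k) f))) q = 0)"
proof (induction r arbitrary: f)
  case (Suc r)
  have c1: "(Dz ^^ k) (Dx f) = Dx ((Dz ^^ k) f)" "(Dz ^^ k) (Dy f) = Dy ((Dz ^^ k) f)"
    "(Dy ^^ k) (Dx f) = Dx ((Dy ^^ k) f)" for k f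
    by (induction k) (auto simp: D_commute)
  have s: "(Dx ^^ i) (Dx g) = (Dx ^^ Suc i) g" "(Dy ^^ i) (Dy g) = (Dy ^^ Suc i) g"
    "(Dz ^^ i) (Dz g) = (Dz ^^ Suc i) g" for i g
    by (simp_all only: funpow_Suc_right o_def)
  show ?case (is "?l \<longleftrightarrow> ?r")
  proof
    assume ?l
    show ?r
    proof (intro allI impI)
      fix i j k :: nat
      assume lt: "i + j + k < Suc r"
      consider "i = 0" "j = 0" "k = 0" | k' where "k = Suc k'" | j' where "k = 0" "j = Suc j'"
        | i' where "k = 0" "j = 0" "i = Suc i'"
        by (metis not0_implies_Suc)
      then show "eval ((Dx ^^ i) ((Dy ^^ j) ((Dz ^^ k) f))) q = 0"
      proof cases
        case 2
        then have "i + j + k' < r" using lt by simp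
        then have "eval ((Dx ^^ i) ((Dy ^^ j) ((Dz ^^ k') (Dz f)))) q = 0"
          using \<open>?l\<close> Suc by auto
        then show ?thesis unfolding s 2 .
      next
        case 3
        then have "i + j' + 0 < r" using lt by simp
        then have "eval ((Dx ^^ i) ((Dy ^^ j') ((Dz ^^ 0) (Dy f)))) q = 0"
          using \<open>?l\<close> Suc by (metis vanish_order.simps(2))
        then show ?thesis unfolding 3 funpow_0 s .
      next
        case 4
        then have "i' + 0 + 0 < r" using lt by simp
        then have "eval ((Dx ^^ i') ((Dy ^^ 0) ((Dz ^^ 0) (Dx f)))) q = 0"
          using \<open>?l\<close> Suc by (metis vanish_order.simps(2))
        then show ?thesis unfolding 4 funpow_0 s .
      qed (use \<open>?l\<close> in simp)
    qed
  next
    assume ?r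
    then have *: "i + j + k < Suc r \<Longrightarrow> eval ((Dx ^^ i) ((Dy ^^ j) ((Dz ^^ k) f))) q = 0" for i j k by blast
    have "eval f q = 0" using *[of 0 0 0] by simp
    moreover have "vanish_order r (Dx f) q" "vanish_order r (Dy f) q" "vanish_order r (Dz f) q"
      unfolding Suc c1 s by (intro allI impI *; simp)+
    ultimately show ?l by simp
  qed
qed simp

lemma vanish_order_0 [simp]: "vanish_order r 0 q"
  by (induction r) auto

lemma vanish_order_add: "vanish_order r f q \<Longrightarrow> vanish_order r g q \<Longrightarrow> vanish_order r (f + g) q"
proof (induction r arbitrary: f g)
  case (Suc r)
  show ?case
    using Suc.prems by (simp add: Suc.IH)
qed simp

lemma vanish_order_Suc: "vanish_order (Suc r) f q \<Longrightarrow> vanish_order r f q"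
proof (induction r arbitrary: f)
  case (Suc r)
  then have "eval f q = 0" "vanish_order (Suc r) (Dx f) q" "vanish_order (Suc r) (Dy f) q" "vanish_order (Suc r) (Dz f) q"
    unfolding vanish_order.simps(2)[of "Suc r"] by blast+
  then show ?case
    using Suc.IH unfolding vanish_order.simps(2)[of r f] by blast
qed simp

lemma vanish_order_mult: "vanish_order r f q \<Longrightarrow> vanish_order r (f * g) q"
proof (induction r arbitrary: f g)
  case (Suc r)
  have "vanish_order r f q" using Suc.prems by (rule vanish_order_Suc)
  moreover have "eval f q = 0" "vanish_order r (Dx f) q" "vanish_order r (Dy f) q" "vanish_order r (Dz f) q"
    using Suc.prems by simp_all
  ultimately show ?case
    by (simp add: D_mult vanish_order_add Suc.IH)
qed simp

text \<open>A partial derivative of the product is a constant times \<open>f\<close> plus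
  \<open>linf c\<close> times a derivative of \<open>f\<close>. Both have the order required one
  step down, the second by induction.\<close>

lemma vanish_order_linf_mult: "dot3 c q = 0 \<Longrightarrow> vanish_order r f q \<Longrightarrow> vanish_order (Suc r) (linf c * f) q"
proof (induction r arbitrary: f)
  case (Suc r)
  have *: "vanish_order (Suc r) (t * f) q" for t
    using vanish_order_mult[OF Suc.prems(2), of t] by (simp add: mult.commute)
  have "vanish_order (Suc r) (linf c * Dx f) q" "vanish_order (Suc r) (linf c * Dy f) q" "vanish_order (Suc r) (linf c * Dz f) q"
    using Suc.prems(2) unfolding vanish_order.simps(2)[of r f] by (blast intro: Suc.IH[OF Suc.prems(1)])+
  moreover have "eval (linf c * f) q = 0"
    using Suc.prems(1) by simp
  ultimately show ?case
    unfolding vanish_order.simps(2)[of "Suc r"] using * by (cases c) (simp del: vanish_order.simps(2) add: D_mult vanish_order_add)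
qed simp

lemma vanish_order_linf_power_mult: "dot3 c q = 0 \<Longrightarrow> vanish_order r f q \<Longrightarrow> vanish_order (n + r) (linf c ^ n * f) q"
proof (induction n)
  case (Suc n)
  then show ?case
    using vanish_order_linf_mult[of c q "n + r" "linf c ^ n * f"] by (simp add: mult.assoc del: vanish_order.simps(2))
qed simp

text \<open>Differentiating in the line parameter is a directional derivative of \<open>f\<close>;
  it lowers the order of vanishing and the index of the coefficient by one each.\<close>

lemma coeff_line_poly_vanish_order: "vanish_order r f q \<Longrightarrow> k < r \<Longrightarrow> coeff (line_poly q v f) k = 0"
proof (induction k arbitrary: f r)
  case 0
  then have "eval f q = 0" by (cases r) auto
  then have "poly (line_poly q v f) 0 = 0"
    by (cases v; cases q) simp
  then show ?case by (simp add: poly_0_coeff_0)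
next
  case (Suc k)
  then obtain r' where r: "r = Suc r'" "k < r'" by (cases r) auto
  have "vanish_order r' (t * Dx f) q" "vanish_order r' (t * Dy f) q" "vanish_order r' (t * Dz f) q" for t
    using Suc.prems(1) by (simp_all add: r vanish_order_mult mult.commute[of t])
  then have "vanish_order r' (dir_deriv v f) q"
    by (cases v) (auto simp: dir_deriv_def intro!: vanish_order_add)
  then have "coeff (pderiv (line_poly q v f)) k = 0"
    using Suc.IH r pderiv_line_poly by metis
  then show ?case
    by (simp add: coeff_pderiv del: of_nat_Suc)
qed

lemma eval_line_affine:
  assumes "dir_deriv q (dir_deriv q f) = 0"
  shows "eval f (v + scale3 s q) = eval f v + s * eval (dir_deriv q f) v"
proof -
  let ?p = "line_poly v q f"
  have z: "v + scale3 0 q = v" by (cases v; cases q) simp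
  have "pderiv (pderiv ?p) = 0"
    using assms by (simp add: pderiv_line_poly)
  then obtain a where a: "pderiv ?p = [:a:]"
    using pderiv_iszero by blast
  have "pderiv (?p - [:0, a:]) = 0"
    by (simp add: pderiv_diff a pderiv_pCons)
  then obtain b where "?p - [:0, a:] = [:b:]"
    using pderiv_iszero by blast
  then have p: "?p = [:b, a:]" by (simp add: algebra_simps)
  have "a = poly (pderiv ?p) 0" by (simp add: a)
  also have "\<dots> = eval (dir_deriv q f) v" by (simp add: pderiv_line_poly z)
  finally have "a = eval (dir_deriv q f) v" .
  moreover have "b = poly ?p 0" by (simp add: p)
  then have "b = eval f v" by (simp add: z)
  moreover have "eval f (v + scale3 s q) = poly ?p s" by simp
  ultimately show ?thesis by (simp add: p)
qed

text \<open>Homogeneity turns the Taylor expansion of \<open>f\<close> at \<open>q\<close> into its expansion along the lines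
  through \<open>q\<close>.\<close>

lemma dir_deriv2_eq_0:
  assumes f: "homogeneous d f" and ord: "vanish_order (d - 1) f q"
  shows "dir_deriv q (dir_deriv q f) = 0"
proof (rule eval_ext)
  fix v
  let ?p = "line_poly q v f" and ?r = "line_poly v q f"
  have z: "v + scale3 0 q = v" by (cases v; cases q) simp
  have "coeff ?p k = 0" if "k \<noteq> d" "k \<noteq> d - 1" for k
  proof (cases "k < d - 1")
    case True
    then show ?thesis using coeff_line_poly_vanish_order ord by blast
  next
    case False
    then have "k > d" using that by linarith
    then show ?thesis using degree_line_poly_le[OF f] by (intro coeff_eq_0) (rule le_less_trans)
  qed
  \<comment> \<open>For \<open>d = 0\<close> the truncated \<open>d - 1\<close> equals
    \<open>d\<close>, and the constant term must not be counted twice.\<close>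
  then have p: "?p = monom (coeff ?p (d - 1)) (d - 1) + (if d = 0 then 0 else monom (coeff ?p d) d)"
    by (auto intro!: poly_eqI)
  have "poly ?r s = poly [:coeff ?p d, (if d = 0 then 0 else coeff ?p (d - 1)):] s" if s: "s \<noteq> 0" for s
  proof -
    \<comment> \<open>The line through \<open>v\<close> in direction \<open>q\<close> is also the
      line through \<open>q\<close> in direction \<open>v\<close>, with parameter 1/s. Homogeneity
      reverses the coefficients, so the surviving degrees \<open>d\<close> and \<open>d - 1\<close>
      become 0 and 1.\<close>
    have "v + scale3 s q = scale3 s (q + scale3 (1 / s) v)"
      using s by (cases v; cases q) (simp add: algebra_simps)
    then have "poly ?r s = s ^ d * poly ?p (1 / s)"
      by (simp add: homogeneous_eval_scale[OF f])
    also have "\<dots> = poly [:coeff ?p d, (if d = 0 then 0 else coeff ?p (d - 1)):] s"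
      by (subst p) (use s in \<open>cases d; simp add: poly_monom field_simps\<close>)
    finally show ?thesis .
  qed
  then have "UNIV - {0} \<subseteq> {s. poly (?r - [:coeff ?p d, (if d = 0 then 0 else coeff ?p (d - 1)):]) s = 0}"
    by auto
  then have "?r - [:coeff ?p d, (if d = 0 then 0 else coeff ?p (d - 1)):] = 0"
    by (metis poly_roots_finite finite_subset infinite_UNIV_char_0 infinite_remove)
  then have "?r = [:coeff ?p d, (if d = 0 then 0 else coeff ?p (d - 1)):]"
    by simp
  then have "pderiv (pderiv ?r) = 0"
    by (simp add: pderiv_pCons)
  then have "poly (line_poly v q (dir_deriv q (dir_deriv q f))) 0 = 0"
    by (simp add: pderiv_line_poly)
  then show "eval (dir_deriv q (dir_deriv q f)) v = eval 0 v"
    by (simp add: z)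
qed

section \<open>Factors of homogeneous polynomials\<close>

text \<open>The polynomial \<open>p\<close> is f(tx, ty, tz) in an auxiliary variable t: its
  coefficients are the homogeneous parts, and products of such polynomials respect the
  grading.\<close>

lemma homogeneous_parts_exist: "\<exists>p :: S poly. (\<forall>k. homogeneous k (coeff p k)) \<and> poly p 1 = f"
proof (induction f rule: S_induct)
  case (const t)
  show ?case
    by (rule exI[of _ "[:const t:]"]) (auto simp: coeff_pCons split: nat.splits)
next
  case X
  show ?case by (rule exI[of _ "monom X 1"]) (auto simp: poly_monom)
next
  case Y
  show ?case by (rule exI[of _ "monom Y 1"]) (auto simp: poly_monom)
next
  case Z
  show ?case by (rule exI[of _ "monom Z 1"]) (auto simp: poly_monom)
next
  case (add f g)
  then obtain p q where "\<forall>k. homogeneous k (coeff p k)" "poly p 1 = f"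
    "\<forall>k. homogeneous k (coeff q k)" "poly q 1 = g" by blast
  then show ?case by (intro exI[of _ "p + q"]) (auto intro: homogeneous_add)
next
  case (mult f g)
  then obtain p q where pq: "\<forall>k. homogeneous k (coeff p k)" "poly p 1 = f"
    "\<forall>k. homogeneous k (coeff q k)" "poly q 1 = g" by blast
  have "homogeneous k (coeff p i * coeff q (k - i))" if "i \<le> k" for i k
    using homogeneous_mult[of i "coeff p i" "k - i" "coeff q (k - i)"] pq that by simp
  then have "homogeneous k (coeff (p * q) k)" for k
    by (auto simp: coeff_mult intro: homogeneous_sum)
  then show ?case using pq by (intro exI[of _ "p * q"]) auto
qed

lemma homogeneous_parts_monom:
  assumes p: "\<And>k. homogeneous k (coeff p k)" and f: "homogeneous d f" "poly p 1 = f"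
  shows "p = monom f d"
proof -
  have m: "monom_coeff f i j l = monom_coeff (coeff p (i + j + l)) i j l" for i j l
  proof -
    have "f = (\<Sum>k\<le>degree p. coeff p k)"
      using f by (simp add: poly_altdef)
    then have "monom_coeff f i j l = (\<Sum>k\<le>degree p. monom_coeff (coeff p k) i j l)"
      by (simp add: monom_coeff_sum)
    also have "\<dots> = (\<Sum>k\<le>degree p. if k = i + j + l then monom_coeff (coeff p (i + j + l)) i j l else 0)"
      using p unfolding homogeneous_def by (intro sum.cong) auto
    also have "\<dots> = monom_coeff (coeff p (i + j + l)) i j l"
      by (auto simp: coeff_eq_0 monom_coeff_def)
    finally show ?thesis .
  qed
  have z: "coeff p k = 0" if "k \<noteq> d" for k
  proof (rule monom_coeff_ext)
    fix i j l
    show "monom_coeff (coeff p k) i j l = monom_coeff 0 i j l"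
    proof (rule ccontr)
      assume "monom_coeff (coeff p k) i j l \<noteq> monom_coeff 0 i j l"
      then have nz: "monom_coeff (coeff p k) i j l \<noteq> 0"
        by (simp add: monom_coeff_def)
      then have k: "i + j + l = k" using p unfolding homogeneous_def by blast
      then have "monom_coeff f i j l \<noteq> 0" using m nz by metis
      then show False using f k that unfolding homogeneous_def by blast
    qed
  qed
  then have "p = monom (coeff p d) d"
    by (intro poly_eqI) auto
  moreover from this have "f = coeff p d"
    using f by (metis poly_monom power_one mult.right_neutral)
  ultimately show ?thesis by simp
qed

lemma homogeneous_unique: "f \<noteq> 0 \<Longrightarrow> homogeneous a f \<Longrightarrow> homogeneous b f \<Longrightarrow> a = b"
  unfolding homogeneous_def by (metis monom_coeff_ext monom_coeff_def coeff_0)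

text \<open>Order at 0 and degree are both additive, the order never exceeds the degree, and for a
  monomial they agree. Hence they agree for each factor.\<close>

lemma monom_factor:
  fixes p q :: "'a :: idom poly"
  assumes pq: "p * q = monom c d" and c: "c \<noteq> 0"
  shows "\<exists>a k. p = monom a k"
proof -
  have nz: "p * q \<noteq> 0" "p \<noteq> 0" "q \<noteq> 0"
    using assms by auto
  have "order 0 p + order 0 q = d"
    using order_mult[OF nz(1), of 0] order_0_monom[OF c] pq by simp
  moreover have "degree p + degree q = d"
    using degree_mult_eq[OF nz(2,3)] pq c by (simp add: degree_monom_eq)
  ultimately have o: "order 0 p = degree p"
    using order_degree[OF nz(2), of 0] order_degree[OF nz(3), of 0] by linarith
  have "monom 1 (degree p) dvd p"
    using order_1[of 0 p] o by (simp add: monom_altdef)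
  then have "coeff p k = 0" if "k < degree p" for k
    using that by (simp add: monom_1_dvd_iff')
  then have "p = monom (coeff p (degree p)) (degree p)"
    by (intro poly_eqI) (metis coeff_monom le_degree nat_neq_iff not_less)
  then show ?thesis by blast
qed

text \<open>In the auxiliary grading variable a form becomes a monomial, and factors of a monomial
  over a domain are monomials.\<close>

lemma homogeneous_factors:
  assumes gh: "homogeneous d (g * h)" "g * h \<noteq> 0"
  shows "\<exists>a b. a + b = d \<and> homogeneous a g \<and> homogeneous b h"
proof -
  obtain p q where p: "\<And>k. homogeneous k (coeff p k)" "poly p 1 = g"
    and q: "\<And>k. homogeneous k (coeff q k)" "poly q 1 = h"
    using homogeneous_parts_exist by meson
  have "homogeneous k (coeff p i * coeff q (k - i))" if "i \<le> k" for i k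
    using homogeneous_mult[of i "coeff p i" "k - i" "coeff q (k - i)"] p q that by simp
  then have "homogeneous k (coeff (p * q) k)" for k
    by (auto simp: coeff_mult intro: homogeneous_sum)
  then have pq: "p * q = monom (g * h) d"
    using homogeneous_parts_monom[of "p * q"] gh p q by simp
  obtain a i b j where "p = monom a i" "q = monom b j"
    using monom_factor[OF pq gh(2)] monom_factor[of q p] pq gh(2) by (metis mult.commute)
  then have "a = g" "b = h" "homogeneous i a" "homogeneous j b"
    using p q by (metis coeff_monom poly_monom power_one mult.right_neutral)+
  then have "homogeneous i g" "homogeneous j h" by auto
  moreover from this have "homogeneous (i + j) (g * h)" by (rule homogeneous_mult)
  ultimately show ?thesis using gh homogeneous_unique by blast
qed

lemma homogeneous_0E:
  assumes "homogeneous 0 f"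
  obtains c where "f = const c"
proof -
  have "mono_index 0 = {(0, 0)}" by (auto simp: mono_index_def)
  then show ?thesis
    using homogeneous_expand[OF assms] that by (auto simp: mono3_def)
qed

lemma unit_homogeneous: "f dvd 1 \<Longrightarrow> homogeneous d f \<Longrightarrow> d = 0"
proof -
  assume "f dvd 1" "homogeneous d f"
  then obtain g where fg: "1 = f * g" by (elim dvdE)
  then have "homogeneous 0 (f * g)" "f * g \<noteq> 0"
    using homogeneous_const[of 1] by auto
  then obtain a b where "a + b = 0" "homogeneous a f" using homogeneous_factors by blast
  moreover have "f \<noteq> 0" using fg by auto
  ultimately show "d = 0" using homogeneous_unique \<open>homogeneous d f\<close> by fastforce
qed

lemma homogeneous_0_unit: "homogeneous 0 f \<Longrightarrow> f \<noteq> 0 \<Longrightarrow> f dvd 1"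
proof (elim homogeneous_0E)
  fix c assume "f \<noteq> 0" "f = const c"
  then have "c \<noteq> 0" by auto
  then have "1 = f * const (1 / c)"
    using const_simps(4)[of c "1 / c"] \<open>f = const c\<close> by simp
  then show "f dvd 1" by (rule dvdI)
qed

lemma irreducible_homogeneousI:
  assumes f: "f \<noteq> 0" "homogeneous d f" "d > 0"
    and *: "\<And>g h a b. f = g * h \<Longrightarrow> homogeneous a g \<Longrightarrow> homogeneous b h \<Longrightarrow> a > 0 \<Longrightarrow> b > 0 \<Longrightarrow> a + b = d \<Longrightarrow> False"
  shows "irreducible f"
proof (rule irreducibleI)
  show "f \<noteq> 0" by fact
  show "\<not> f dvd 1" using unit_homogeneous f by blast
  fix g h assume gh: "f = g * h"
  then obtain a b where ab: "a + b = d" "homogeneous a g" "homogeneous b h"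
    using homogeneous_factors f by blast
  have "g \<noteq> 0" "h \<noteq> 0" using gh f by auto
  then show "g dvd 1 \<or> h dvd 1"
    using * gh ab homogeneous_0_unit by (metis gr0I)
qed

lemma irreducible_linf: "c \<noteq> 0 \<Longrightarrow> irreducible (linf c)"
  by (rule irreducible_homogeneousI[of _ "Suc 0"]) auto

section \<open>Points, lines and generic points\<close>

lemma scale3_simps [simp]:
  "scale3 s (scale3 t v) = scale3 (s * t) v" "scale3 1 v = v"
  "dot3 c (scale3 t v) = t * dot3 c v" "dot3 (scale3 t c) v = t * dot3 c v"
  "scale3 t v = 0 \<longleftrightarrow> t = 0 \<or> v = 0" "dot3 c 0 = 0"
  by (cases v; cases c; auto simp: zero_prod_def algebra_simps)+

lemma cross3_dot3: "dot3 (cross3 a b) c = dot3 a (cross3 b c)"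
  by (cases a; cases b; cases c) (simp add: algebra_simps)

lemma cross3_self [simp]: "dot3 a (cross3 a b) = 0" "dot3 b (cross3 a b) = 0"
  by (cases a; cases b; simp add: algebra_simps)+

lemma cross3_eq_0D:
  assumes "cross3 u v = 0" "u \<noteq> 0" "v \<noteq> 0"
  shows "\<exists>t. t \<noteq> 0 \<and> u = scale3 t v"
proof -
  obtain a b c where v: "v = (a, b, c)" by (cases v)
  obtain x y z where u: "u = (x, y, z)" by (cases u)
  have eqs: "y * c = z * b" "z * a = x * c" "x * b = y * a"
    using assms(1) by (auto simp: u v zero_prod_def)
  consider "a \<noteq> 0" | "b \<noteq> 0" | "c \<noteq> 0"
    using assms(3) by (auto simp: v zero_prod_def)
  then have "\<exists>t. u = scale3 t v"
  proof cases
    case 1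
    then show ?thesis using eqs by (intro exI[of _ "x / a"]) (auto simp: u v field_simps)
  next
    case 2
    then show ?thesis using eqs by (intro exI[of _ "y / b"]) (auto simp: u v field_simps)
  next
    case 3
    then show ?thesis using eqs by (intro exI[of _ "z / c"]) (auto simp: u v field_simps)
  qed
  then show ?thesis using assms by auto
qed

definition pt :: "complex \<times> complex \<times> complex \<Rightarrow> proj2" where
  "pt v = Proj2 {scale3 t v | t. t \<noteq> 0}"

lemma proportional_class: "v \<noteq> 0 \<Longrightarrow> proportional `` {v} = {scale3 t v | t. t \<noteq> 0}"
  by (auto simp: proportional_def)

lemma coords_pt: "v \<noteq> 0 \<Longrightarrow> coords (pt v) = {scale3 t v | t. t \<noteq> 0}"
  unfolding pt_def
  by (rule Proj2_inverse) (auto simp: proportional_class[symmetric] intro!: quotientI)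

lemma pt_cases: obtains v where "v \<noteq> 0" "p = pt v"
proof -
  have "coords p \<in> (UNIV - {0}) // proportional" by (rule coords)
  then obtain v where "v \<in> UNIV - {0}" "coords p = proportional `` {v}"
    by (rule quotientE)
  then have v: "v \<noteq> 0" "coords p = proportional `` {v}"
    by simp_all
  then have "p = pt v"
    unfolding pt_def using coords_inverse[of p] proportional_class[of v] by simp
  then show ?thesis using v that by blast
qed

lemma coords_pt_self: "v \<noteq> 0 \<Longrightarrow> v \<in> coords (pt v)"
  unfolding coords_pt mem_Collect_eq by (rule exI[of _ 1]) simp

lemma ball_coords_pt: "v \<noteq> 0 \<Longrightarrow> (\<forall>u\<in>coords (pt v). P u) \<longleftrightarrow> (\<forall>t. t \<noteq> 0 \<longrightarrow> P (scale3 t v))"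
  unfolding coords_pt by blast

lemma pt_eq:
  assumes "v \<noteq> 0" "v \<in> coords p"
  shows "p = pt v"
proof -
  obtain u where u: "u \<noteq> 0" "p = pt u" by (rule pt_cases)
  with assms obtain t where t: "t \<noteq> 0" "v = scale3 t u" by (auto simp: coords_pt)
  have "coords (pt v) = coords (pt u)"
  proof (intro equalityI subsetI)
    fix w assume "w \<in> coords (pt u)"
    then obtain s where "s \<noteq> 0" "w = scale3 s u" using u by (auto simp: coords_pt)
    then have "w = scale3 (s / t) v" "s / t \<noteq> 0" using t by auto
    then show "w \<in> coords (pt v)" using assms by (auto simp: coords_pt simp del: scale3_simps)
  qed (use t u assms in \<open>auto simp: coords_pt\<close>)
  then show ?thesis using u coords_inject by metis
qed

text \<open>A finite union of lines is the zero set of the product of their linear forms; this is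
  the closed set to be avoided.\<close>

lemma genericallyI:
  assumes "finite C" "0 \<notin> C" "\<And>v. v \<noteq> 0 \<Longrightarrow> (\<And>c. c \<in> C \<Longrightarrow> dot3 c v \<noteq> 0) \<Longrightarrow> P (pt v)"
  shows "generically P"
proof -
  let ?f = "\<Prod>c\<in>C. linf c"
  let ?W = "{p. \<forall>f\<in>{?f}. vanishes_at f p}"
  have "\<exists>d. homogeneous d ?f"
    using homogeneous_prod[of C "\<lambda>_. Suc 0" linf] by auto
  then have "zariski_closed ?W" unfolding zariski_closed_def by blast
  moreover obtain w where "w \<noteq> 0" "\<forall>c\<in>C. dot3 c w \<noteq> 0"
    using avoid_lines assms by blast
  then have "pt w \<notin> ?W"
    using assms(1) coords_pt_self[of w] by (auto simp: vanishes_at_def simp del: split_paired_All)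
  then have "?W \<noteq> UNIV" by blast
  moreover have "P q" if "q \<notin> ?W" for q
  proof -
    from that obtain v where v: "v \<in> coords q" "\<forall>c\<in>C. dot3 c v \<noteq> 0"
      using assms(1) by (auto simp: vanishes_at_def)
    obtain u where u: "u \<noteq> 0" "q = pt u" by (rule pt_cases)
    then have "v \<noteq> 0" using v by (auto simp: coords_pt)
    then show ?thesis using assms(3)[of v] v pt_eq by metis
  qed
  ultimately show ?thesis unfolding generically_def by blast
qed

text \<open>Nonempty open sets meet. This refutes a generic statement by showing that it fails off
  finitely many lines.\<close>

lemma generically_meets_open:
  assumes "generically P" "finite C" "0 \<notin> C"
  shows "\<exists>v. v \<noteq> 0 \<and> (\<forall>c\<in>C. dot3 c v \<noteq> 0) \<and> P (pt v)"
proof -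
  obtain F where F: "{p. \<forall>f\<in>F. vanishes_at f p} \<noteq> UNIV" "\<And>q. q \<notin> {p. \<forall>f\<in>F. vanishes_at f p} \<Longrightarrow> P q"
    using assms(1) unfolding generically_def zariski_closed_def by auto
  then obtain f p where f: "f \<in> F" "\<not> vanishes_at f p" by auto
  then have "f \<noteq> 0" by (auto simp: vanishes_at_def)
  then obtain w where w: "w \<noteq> 0" "eval f w \<noteq> 0" "\<forall>c\<in>C. dot3 c w \<noteq> 0"
    using avoid_lines_and_form assms by blast
  have "\<not> vanishes_at f (pt w)"
    using w coords_pt_self unfolding vanishes_at_def by blast
  then have "P (pt w)" using F(2) f by blast
  then show ?thesis using w by blast
qed

section \<open>The lines of the arrangement\<close>

text \<open>One normalized coefficient vector per line, so that distinct vectors are never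
  proportional. The same vectors are coordinates of the dual points, which can thus be counted and
  evaluated without passing to classes.\<close>

definition linecoeffs :: "nat \<Rightarrow> (complex \<times> complex \<times> complex) set" where
  "linecoeffs m = insert (1, 0, 0) ((\<lambda>\<zeta>. (1, - \<zeta>, 0)) ` {\<zeta>. \<zeta> ^ m = 1} \<union>
     (\<lambda>\<zeta>. (0, 1, - \<zeta>)) ` {\<zeta>. \<zeta> ^ m = 1} \<union> (\<lambda>\<zeta>. (- \<zeta>, 0, 1)) ` {\<zeta>. \<zeta> ^ m = 1})"

lemma finite_linecoeffs [simp]: "m \<ge> 1 \<Longrightarrow> finite (linecoeffs m)"
  by (auto simp: linecoeffs_def intro!: finite_imageI finite_roots_unity)

lemma zero_notin_linecoeffs [simp]: "0 \<notin> linecoeffs m"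
  by (auto simp: linecoeffs_def zero_prod_def)

lemma card_linecoeffs: "m \<ge> 1 \<Longrightarrow> card (linecoeffs m) = 3 * m + 1"
proof -
  assume m: "m \<ge> 1"
  define U where "U = {\<zeta>::complex. \<zeta> ^ m = 1}"
  have U: "finite U" "card U = m" "0 \<notin> U"
    using m by (auto simp: U_def intro: finite_roots_unity simp: card_roots_unity_eq power_0_left)
  define A :: "(complex \<times> complex \<times> complex) set" where "A = (\<lambda>\<zeta>. (1, - \<zeta>, 0)) ` U"
  define B :: "(complex \<times> complex \<times> complex) set" where "B = (\<lambda>\<zeta>. (0, 1, - \<zeta>)) ` U"
  define C :: "(complex \<times> complex \<times> complex) set" where "C = (\<lambda>\<zeta>. (- \<zeta>, 0, 1)) ` U"
  have card: "card A = m" "card B = m" "card C = m"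
    unfolding A_def B_def C_def by (subst card_image; simp add: inj_on_def U)+
  have fin: "finite A" "finite B" "finite C"
    unfolding A_def B_def C_def by (intro finite_imageI U(1))+
  have disj: "A \<inter> B = {}" "(A \<union> B) \<inter> C = {}" "(1, 0, 0) \<notin> A \<union> B \<union> C"
  proof -
    have a: "fst a = 1" "fst (snd a) \<noteq> 0" "snd (snd a) = 0" if "a \<in> A" for a
      using that U(3) unfolding A_def by (elim imageE; simp; metis)+
    have b: "fst b = 0" "fst (snd b) = 1" if "b \<in> B" for b
      using that unfolding B_def by (elim imageE; simp)+
    have c: "snd (snd c) = 1" "fst c \<noteq> 0" if "c \<in> C" for c
      using that U(3) unfolding C_def by (elim imageE; simp; metis)+
    show "A \<inter> B = {}"
      using a b by (metis disjoint_iff zero_neq_one)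
    show "(A \<union> B) \<inter> C = {}"
    proof (intro equalityI subsetI)
      fix v assume "v \<in> (A \<union> B) \<inter> C"
      then have "v \<in> A \<or> v \<in> B" "v \<in> C" by blast+
      then show "v \<in> {}" using a(3)[of v] b(1)[of v] c[of v] by (elim disjE) simp_all
    qed simp
    show "(1, 0, 0) \<notin> A \<union> B \<union> C"
      using a(2)[of "(1, 0, 0)"] b(1)[of "(1, 0, 0)"] c(1)[of "(1, 0, 0)"] by simp blast
  qed
  have "card (A \<union> B) = m + m"
    using card_Un_disjoint[OF fin(1,2) disj(1)] card by simp
  then have "card (A \<union> B \<union> C) = m + m + m"
    using card_Un_disjoint[OF _ fin(3) disj(2)] fin card by simp
  then have "card (insert (1, 0, 0) (A \<union> B \<union> C)) = 3 * m + 1"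
    using fin disj(3) by simp
  then show ?thesis
    unfolding linecoeffs_def A_def B_def C_def U_def .
qed

lemma power_eq_iff_root:
  fixes x y :: complex
  assumes "m \<ge> 1"
  shows "x ^ m = y ^ m \<longleftrightarrow> (\<exists>\<zeta>. \<zeta> ^ m = 1 \<and> x = \<zeta> * y)"
proof
  assume h: "x ^ m = y ^ m"
  show "\<exists>\<zeta>. \<zeta> ^ m = 1 \<and> x = \<zeta> * y"
  proof (cases "y = 0")
    case True
    then show ?thesis using h assms by (intro exI[of _ 1]) (auto simp: power_0_left)
  next
    case False
    then show ?thesis using h by (intro exI[of _ "x / y"]) (auto simp: power_divide)
  qed
qed (auto simp: power_mult_distrib)

lemma eval_f1_eq_0_iff:
  assumes "m \<ge> 1"
  shows "eval (f1 m) v = 0 \<longleftrightarrow> (\<exists>c\<in>linecoeffs m. dot3 c v = 0)"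
proof -
  obtain x y z where v: "v = (x, y, z)" by (cases v)
  have "eval (f1 m) v = 0 \<longleftrightarrow> x = 0 \<or> x ^ m = y ^ m \<or> y ^ m = z ^ m \<or> z ^ m = x ^ m"
    by (simp add: f1_def v)
  also have "\<dots> \<longleftrightarrow> (\<exists>c\<in>linecoeffs m. dot3 c v = 0)"
    unfolding power_eq_iff_root[OF assms] linecoeffs_def
    by (auto simp: v bex_Un algebra_simps)
  finally show ?thesis .
qed

lemma linecoeffs_cross3:
  assumes "m \<ge> 1" "c \<in> linecoeffs m" "c' \<in> linecoeffs m" "c \<noteq> c'"
  shows "cross3 c c' \<noteq> 0"
  using assms by (auto simp: linecoeffs_def zero_prod_def)

definition line :: "complex \<times> complex \<times> complex \<Rightarrow> proj2 set" where
  "line c = {q. \<forall>v\<in>coords q. dot3 c v = 0}"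

lemma dual_line_pt: "c \<noteq> 0 \<Longrightarrow> dual_line (pt c) = line c"
  unfolding dual_line_def line_def using ball_coords_pt[of c] by force

lemma pt_in_line: "v \<noteq> 0 \<Longrightarrow> pt v \<in> line c \<longleftrightarrow> dot3 c v = 0"
  unfolding line_def using ball_coords_pt[of v] by force

text \<open>The points of the line of \<open>l\<close> are the vectors l x w, and c . (l x w) = (c x
  l) . w. If no \<open>c\<close> is proportional to \<open>l\<close>, a vector \<open>w\<close> off
  finitely many lines yields a point of that line lying on no line of the arrangement.\<close>

lemma line_in_A1_iff:
  assumes m: "m \<ge> 1" and l: "l \<noteq> 0"
  shows "(\<forall>p\<in>line l. vanishes_at (f1 m) p) \<longleftrightarrow> (\<exists>c\<in>linecoeffs m. pt l = pt c)"
proof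
  assume *: "\<forall>p\<in>line l. vanishes_at (f1 m) p"
  show "\<exists>c\<in>linecoeffs m. pt l = pt c"
  proof (rule ccontr)
    assume no: "\<not> ?thesis"
    have "cross3 c l \<noteq> 0" if c: "c \<in> linecoeffs m" for c
    proof
      assume "cross3 c l = 0"
      moreover have "c \<noteq> 0" using c by auto
      ultimately obtain t where "t \<noteq> 0" "c = scale3 t l" using cross3_eq_0D l by blast
      then have "c \<in> coords (pt l)" using l by (auto simp: coords_pt)
      then show False using no c \<open>c \<noteq> 0\<close> pt_eq by blast
    qed
    then have "0 \<notin> (\<lambda>c. cross3 c l) ` linecoeffs m" by (metis imageE)
    then obtain w where w: "\<forall>c\<in>linecoeffs m. dot3 (cross3 c l) w \<noteq> 0"
      using avoid_lines[of "(\<lambda>c. cross3 c l) ` linecoeffs m"] m by auto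
    let ?v = "cross3 l w"
    have "(1, 0, 0) \<in> linecoeffs m" by (simp add: linecoeffs_def)
    then have v: "?v \<noteq> 0" using w unfolding cross3_dot3 by force
    then have "pt ?v \<in> line l" by (simp add: pt_in_line)
    then have "eval (f1 m) ?v = 0"
      using * coords_pt_self[OF v] unfolding vanishes_at_def by blast
    then show False using w m by (auto simp: eval_f1_eq_0_iff cross3_dot3)
  qed
next
  assume "\<exists>c\<in>linecoeffs m. pt l = pt c"
  then obtain c where c: "c \<in> linecoeffs m" "pt l = pt c" by blast
  then have "c \<noteq> 0" by auto
  then have "line l = line c" using c l dual_line_pt by metis
  then show "\<forall>p\<in>line l. vanishes_at (f1 m) p"
    using c m by (auto simp: line_def vanishes_at_def eval_f1_eq_0_iff)
qed

lemma A1_eq: assumes m: "m \<ge> 1" shows "A1 m = line ` linecoeffs m"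
proof (intro equalityI subsetI)
  fix L assume "L \<in> A1 m"
  then obtain p where p: "L = dual_line p" "\<forall>q\<in>L. vanishes_at (f1 m) q"
    by (auto simp: A1_def arrangement_def)
  obtain l where l: "l \<noteq> 0" "p = pt l" by (rule pt_cases)
  then obtain c where c: "c \<in> linecoeffs m" "pt l = pt c"
    using p line_in_A1_iff[OF m l(1)] by (auto simp: dual_line_pt)
  moreover from this have "c \<noteq> 0" by auto
  ultimately show "L \<in> line ` linecoeffs m" using p l dual_line_pt by (metis imageI)
next
  fix L assume "L \<in> line ` linecoeffs m"
  then obtain c where c: "c \<in> linecoeffs m" "L = line c" by blast
  then have "c \<noteq> 0" by auto
  then show "L \<in> A1 m"
    using c line_in_A1_iff[OF m, of c] dual_line_pt[of c] unfolding A1_def arrangement_def by blast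
qed

lemma dual_points_A1: assumes m: "m \<ge> 1" shows "dual_points (A1 m) = pt ` linecoeffs m"
proof (intro equalityI subsetI)
  fix p assume p: "p \<in> dual_points (A1 m)"
  obtain l where l: "l \<noteq> 0" "p = pt l" by (rule pt_cases)
  then show "p \<in> pt ` linecoeffs m"
    using p line_in_A1_iff[OF m l(1)] by (auto simp: dual_points_def A1_def arrangement_def dual_line_pt)
next
  fix p assume "p \<in> pt ` linecoeffs m"
  then obtain c where c: "c \<in> linecoeffs m" "p = pt c" by blast
  then have "c \<noteq> 0" by auto
  then show "p \<in> dual_points (A1 m)"
    using c m by (auto simp: dual_points_def A1_eq dual_line_pt)
qed

text \<open>Each case picks an intersection point through which few lines pass. For \<open>x\<close>
  nonzero and \<open>v\<close> other than (1:0:0) it is a double point (0:1:\<zeta>), on x = 0 and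
  on one line of y^m = z^m; one of two roots \<zeta> keeps \<open>v\<close> off the latter. For v =
  (1:0:0) it is (0:0:1), whose lines are x = 0 and x = \<zeta> y. For \<open>v\<close> on x = 0 but
  not a vertex it is a triple point (1:1:b), with \<open>b\<close> keeping \<open>v\<close> off the
  line by = z. For the two remaining vertices it is (1:0:0), which lies on the lines y = \<zeta> z
  only.\<close>

lemma unjoined_intersection_point:
  assumes m: "m \<ge> 2" and v: "v \<noteq> 0"
  shows "\<exists>v' c c'. v' \<noteq> 0 \<and> c \<in> linecoeffs m \<and> c' \<in> linecoeffs m \<and> c \<noteq> c' \<and> dot3 c v' = 0 \<and> dot3 c' v' = 0
    \<and> (\<forall>l\<in>linecoeffs m. \<not> (dot3 l v' = 0 \<and> dot3 l v = 0))"
proof -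
  let ?U = "{\<zeta>::complex. \<zeta> ^ m = 1}"
  obtain x y z where xyz: "v = (x, y, z)" by (cases v)
  have "\<not> ?U \<subseteq> {1}"
    using card_roots_unity_eq[of m] card_mono[of "{1}" ?U] m by auto
  then obtain \<omega> :: complex where w: "\<omega> ^ m = 1" "\<omega> \<noteq> 1" by blast
  have nz: "\<zeta> \<noteq> 0" if "\<zeta> ^ m = 1" for \<zeta> :: complex using that m by (auto simp: power_0_left)
  consider "x \<noteq> 0" "y \<noteq> 0 \<or> z \<noteq> 0" | "x \<noteq> 0" "y = 0" "z = 0" | "x = 0" "y \<noteq> 0" "z \<noteq> 0"
    | "x = 0" "y = 0 \<or> z = 0" by blast
  then show ?thesis
  proof cases
    case 1
    then obtain \<zeta> where \<zeta>: "\<zeta> ^ m = 1" "z \<noteq> \<zeta> * y"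
      using w by (metis mult_cancel_right1 mult_1 power_one mult_zero_right)
    have "(\<zeta> * y - z) \<noteq> 0" using \<zeta> by auto
    have inv: "(1 / \<zeta>) ^ m = 1" using \<zeta> by (simp add: power_divide)
    show ?thesis
      by (rule exI[of _ "(0, 1, \<zeta>)"], rule exI[of _ "(1, 0, 0)"], rule exI[of _ "(0, 1, - (1 / \<zeta>))"])
        (use 1 \<zeta> inv nz[OF \<zeta>(1)] in \<open>auto simp: linecoeffs_def xyz zero_prod_def field_simps\<close>)
  next
    case 2
    show ?thesis
      by (rule exI[of _ "(0, 0, 1)"], rule exI[of _ "(1, 0, 0)"], rule exI[of _ "(1, -1, 0)"])
        (use 2 m in \<open>auto simp: linecoeffs_def xyz zero_prod_def power_0_left\<close>)
  next
    case 3
    then obtain b where b: "b ^ m = 1" "b * y \<noteq> z"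
      using w by (metis mult_cancel_right1 mult_1 power_one mult_zero_right)
    show ?thesis
      by (rule exI[of _ "(1, 1, b)"], rule exI[of _ "(1, -1, 0)"], rule exI[of _ "(- b, 0, 1)"])
        (use 3 b in \<open>auto simp: linecoeffs_def xyz zero_prod_def field_simps\<close>)
  next
    case 4
    show ?thesis
      by (rule exI[of _ "(1, 0, 0)"], rule exI[of _ "(0, 1, -1)"], rule exI[of _ "(0, 1, -\<omega>)"])
        (use 4 w nz m v in \<open>auto simp: linecoeffs_def xyz zero_prod_def\<close>)
  qed
qed

lemma line_inj:
  assumes "cross3 c c' \<noteq> 0"
  shows "line c \<noteq> line c'"
proof
  assume eq: "line c = line c'"
  obtain w where "dot3 (cross3 c' c) w \<noteq> 0"
    using avoid_lines[of "{cross3 c' c}"] assms by (cases c; cases c') (auto simp: zero_prod_def algebra_simps)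
  then have w: "dot3 c' (cross3 c w) \<noteq> 0" by (simp add: cross3_dot3)
  then have "cross3 c w \<noteq> 0" by force
  then show False using w eq pt_in_line cross3_self(1) by metis
qed

lemma A1_not_supersolvable:
  assumes m: "m \<ge> 2"
  shows "\<not> supersolvable (A1 m)"
proof
  assume "supersolvable (A1 m)"
  then obtain p where p: "modular_point (A1 m) p" by (auto simp: supersolvable_def)
  obtain v where v: "v \<noteq> 0" "p = pt v" by (rule pt_cases)
  obtain v' c c' where v': "v' \<noteq> 0" "c \<in> linecoeffs m" "c' \<in> linecoeffs m" "c \<noteq> c'" "dot3 c v' = 0" "dot3 c' v' = 0"
    and un: "\<And>l. l \<in> linecoeffs m \<Longrightarrow> dot3 l v' = 0 \<Longrightarrow> dot3 l v \<noteq> 0"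
    using unjoined_intersection_point[OF m v(1)] by blast
  have A: "A1 m = line ` linecoeffs m" using A1_eq m by simp
  have "line c \<noteq> line c'" by (rule line_inj, rule linecoeffs_cross3[of m]) (use v' m in simp_all)
  then have int: "pt v' \<in> intersection_points (A1 m)"
    unfolding intersection_points_def A using v' pt_in_line by blast
  have no: "\<not> (\<exists>L\<in>A1 m. p \<in> L \<and> pt v' \<in> L)"
    unfolding A using un v v' by (auto simp: pt_in_line)
  \<comment> \<open>A modular point lies on some line of the arrangement, and such a line would join
    it to itself.\<close>
  moreover have "pt v' \<noteq> p"
    using p no unfolding modular_point_def intersection_points_def by blast
  ultimately show False using p int unfolding modular_point_def by blast
qed

section \<open>Curves with a generic point of high multiplicity\<close>

text \<open>A point \<open>q\<close> avoiding these lines sees distinct points of the configuration in distinct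
  directions (the cross products), and the line dual to \<open>q\<close> misses every point where the
  derivation \<open>(x^(m+1), y^(m+1), z^(m+1))\<close> is proportional to the Euler derivation (the
  remaining lines).\<close>

definition avoided_lines :: "nat \<Rightarrow> (complex \<times> complex \<times> complex) set" where
  "avoided_lines m = {(1, 0, 0), (0, 0, 1)} \<union> (\<lambda>\<zeta>. (\<zeta>, 0, 1)) ` {\<zeta>. \<zeta> ^ m = 1}
     \<union> (\<lambda>(\<alpha>, \<gamma>). (\<alpha>, 1, \<gamma>)) ` (insert 0 {\<zeta>. \<zeta> ^ m = 1} \<times> insert 0 {\<zeta>. \<zeta> ^ m = 1})
     \<union> (\<lambda>(p, p'). cross3 p p') ` {(p, p'). p \<in> linecoeffs m \<and> p' \<in> linecoeffs m \<and> p \<noteq> p'}"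

lemma finite_avoided_lines: "m \<ge> 1 \<Longrightarrow> finite (avoided_lines m)"
proof -
  assume m: "m \<ge> 1"
  then have "finite {(p, p'). p \<in> linecoeffs m \<and> p' \<in> linecoeffs m \<and> p \<noteq> p'}"
    by (intro finite_subset[OF _ finite_cartesian_product[of "linecoeffs m" "linecoeffs m"]]) auto
  then show ?thesis
    using m unfolding avoided_lines_def
    by (intro finite_UnI finite_imageI finite_cartesian_product finite.insertI finite_roots_unity) auto
qed

lemma zero_notin_avoided_lines: "m \<ge> 1 \<Longrightarrow> 0 \<notin> avoided_lines m"
proof
  assume m: "m \<ge> 1" and "0 \<in> avoided_lines m"
  then have "(0 :: complex \<times> complex \<times> complex) \<in> (\<lambda>(p, p'). cross3 p p') ` {(p, p'). p \<in> linecoeffs m \<and> p' \<in> linecoeffs m \<and> p \<noteq> p'}"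
    unfolding avoided_lines_def by (auto simp: zero_prod_def)
  then obtain p p' where "p \<in> linecoeffs m" "p' \<in> linecoeffs m" "p \<noteq> p'" "cross3 p p' = 0"
    by (elim imageE) (simp add: split_beta, blast)
  then show False using linecoeffs_cross3[OF m] by blast
qed

lemma dir_deriv_linf [simp]: "dir_deriv q (linf l) = const (dot3 l q)"
  by (cases q; cases l) (simp add: dir_deriv_def algebra_simps)

lemma dir_deriv_power: "dir_deriv q (f ^ n) = of_nat n * f ^ (n - 1) * dir_deriv q f"
  by (cases q) (simp add: dir_deriv_def D_power algebra_simps)

lemma dir_deriv_gens [simp]: "dir_deriv (a, b, c) X = const a" "dir_deriv (a, b, c) Y = const b" "dir_deriv (a, b, c) Z = const c"
  "dir_deriv q (const t) = 0" "dir_deriv q 0 = 0"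
  by (cases q; simp add: dir_deriv_def)+

text \<open>\<open>p \<bullet> \<theta>(p \<times> q)\<close> as a form in \<open>p\<close>, for
  \<open>\<theta> = (x^(m+1), y^(m+1), z^(m+1))\<close>.\<close>

definition unexpected_curve :: "nat \<Rightarrow> complex \<times> complex \<times> complex \<Rightarrow> S" where
  "unexpected_curve m = (\<lambda>(a, b, c). X * linf (0, c, - b) ^ (m + 1) + Y * linf (- c, 0, a) ^ (m + 1)
     + Z * linf (b, - a, 0) ^ (m + 1))"

lemma homogeneous_unexpected_curve: "homogeneous (m + 2) (unexpected_curve m q)"
proof -
  have "homogeneous (Suc 0 + (m + 1)) (f * linf l ^ (m + 1))" if "homogeneous (Suc 0) f" for f l
    using that by (intro homogeneous_mult homogeneous_power1) auto
  then have "homogeneous (Suc 0 + (m + 1)) (unexpected_curve m q)"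
    unfolding unexpected_curve_def by (cases q) (auto intro!: homogeneous_add)
  then show ?thesis by simp
qed

text \<open>The three linear forms are the coordinates of p x q and vanish at p = q; each summand
  contains the power m + 1 of one of them.\<close>

lemma vanish_order_unexpected_curve: "vanish_order (m + 1) (unexpected_curve m q) (scale3 t q)"
proof -
  have "vanish_order (m + 1 + 0) (linf l ^ (m + 1) * f) (scale3 t q)" if "dot3 l q = 0" for l f
    by (rule vanish_order_linf_power_mult) (use that in auto)
  then have *: "vanish_order (m + 1) (f * linf l ^ (m + 1)) (scale3 t q)" if "dot3 l q = 0" for l f
    using that by (metis mult.commute add.right_neutral)
  obtain a b c where q: "q = (a, b, c)" by (cases q)
  have "dot3 (0, c, - b) q = 0" "dot3 (- c, 0, a) q = 0" "dot3 (b, - a, 0) q = 0"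
    by (simp_all add: q)
  note 1 = this[THEN *]
  have "unexpected_curve m q = X * linf (0, c, - b) ^ (m + 1) + Y * linf (- c, 0, a) ^ (m + 1)
     + Z * linf (b, - a, 0) ^ (m + 1)"
    unfolding unexpected_curve_def q prod.case ..
  then show ?thesis
    using 1 by (simp only: vanish_order_add)
qed

text \<open>The coordinates of p x q are constant in the direction q, so only the outer factors are
  differentiated, leaving q . \<theta>(p x q).\<close>

lemma dir_deriv_unexpected_curve:
  "dir_deriv (a, b, c) (unexpected_curve m (a, b, c)) = const a * linf (0, c, - b) ^ (m + 1)
     + const b * linf (- c, 0, a) ^ (m + 1) + const c * linf (b, - a, 0) ^ (m + 1)"
  unfolding unexpected_curve_def prod.case by (simp add: dir_deriv_add dir_deriv_mult dir_deriv_power del: power_Suc)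

lemma dir_deriv2_unexpected_curve: "dir_deriv q (dir_deriv q (unexpected_curve m q)) = 0"
  using dir_deriv2_eq_0[OF homogeneous_unexpected_curve, of m q q] vanish_order_unexpected_curve[of m q 1] by simp

text \<open>The vector l x q lies on the line with coefficients \<open>l\<close>, and tangency of
  \<theta> means that l . \<theta> vanishes along this line.\<close>

lemma unexpected_curve_through:
  assumes "m \<ge> 1" "l \<in> linecoeffs m"
  shows "eval (unexpected_curve m q) l = 0"
  using assms
  by (cases q) (auto simp: linecoeffs_def unexpected_curve_def algebra_simps power_mult_distrib power_minus')

text \<open>Otherwise some line in the direction \<open>q\<close> would see both factors with
  positive degree, although the product restricts to degree at most 1.\<close>

lemma factor_constant_along:
  assumes "dir_deriv q (dir_deriv q (g * h)) = 0"
  shows "dir_deriv q g = 0 \<or> dir_deriv q h = 0"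
proof (rule ccontr)
  assume "\<not> ?thesis"
  then have "dir_deriv q g * dir_deriv q h \<noteq> 0" by simp
  then obtain v where "eval (dir_deriv q g * dir_deriv q h) v \<noteq> 0" using eval_nonzero by blast
  then have v: "eval (dir_deriv q g) v \<noteq> 0" "eval (dir_deriv q h) v \<noteq> 0" by auto
  have z: "v + scale3 0 q = v" by (cases v; cases q) simp
  have pos: "degree (line_poly v q f) \<noteq> 0" if "eval (dir_deriv q f) v \<noteq> 0" for f
  proof
    assume "degree (line_poly v q f) = 0"
    then have "line_poly v q (dir_deriv q f) = 0"
      using pderiv_eq_0_iff[of "line_poly v q f"] by (simp add: pderiv_line_poly)
    then show False using that poly_line_poly[of v q "dir_deriv q f" 0] by (simp add: z)
  qed
  have "degree (pderiv (line_poly v q (g * h))) = 0"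
    using assms pderiv_eq_0_iff[of "pderiv (line_poly v q (g * h))"] by (simp add: pderiv_line_poly del: line_poly_mult)
  then have "degree (line_poly v q g * line_poly v q h) \<le> 1"
    by (simp add: degree_pderiv)
  moreover have "degree (line_poly v q g * line_poly v q h) = degree (line_poly v q g) + degree (line_poly v q h)"
    by (rule degree_mult_eq) (use pos[OF v(1)] pos[OF v(2)] in auto)
  ultimately show False using pos[OF v(1)] pos[OF v(2)] by linarith
qed

section \<open>Projection from a generic point\<close>

locale generic_point =
  fixes m :: nat and a b c :: complex
  assumes m3: "m \<ge> 3"
    and generic: "\<And>l. l \<in> avoided_lines m \<Longrightarrow> dot3 l (a, b, c) \<noteq> 0"
begin

abbreviation q where "q \<equiv> (a, b, c)"

text \<open>Restriction to the line \<open>z = 0\<close>, which parametrizes the pencil of lines through \<open>q\<close>;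
  the line joining \<open>q\<close> to a point meets it at \<open>(1, slope, 0)\<close>.\<close>

definition res :: "S \<Rightarrow> complex poly" where "res = line_poly (1, 0, 0) (0, 1, 0)"

fun slope where "slope (x, y, z) = (y * c - z * b) / (x * c - z * a)"

lemma poly_res [simp]: "poly (res f) s = eval f (1, s, 0)"
  by (simp add: res_def)

lemma degree_res: "homogeneous d f \<Longrightarrow> degree (res f) \<le> d"
  unfolding res_def by (rule degree_line_poly_le)

lemma ac_nz: "a \<noteq> 0" "c \<noteq> 0"
  using generic[of "(1, 0, 0)"] generic[of "(0, 0, 1)"] by (auto simp: avoided_lines_def)

lemma root_nz: "\<zeta> ^ m = 1 \<Longrightarrow> \<zeta> * a + c \<noteq> 0"
  using generic[of "(\<zeta>, 0, 1)"] by (auto simp: avoided_lines_def)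

lemma roots_nz: "\<alpha> = 0 \<or> \<alpha> ^ m = 1 \<Longrightarrow> \<gamma> = 0 \<or> \<gamma> ^ m = 1 \<Longrightarrow> \<alpha> * a + b + \<gamma> * c \<noteq> 0"
  using generic[of "(\<alpha>, 1, \<gamma>)"] by (force simp: avoided_lines_def)

text \<open>Subtracting z/c times \<open>q\<close> moves the point into the line z = 0, where it
  becomes (xc - za)/c times (1, slope, 0). The affine expansion in the direction \<open>q\<close>
  then gives the formula.\<close>

lemma eval_via_res:
  assumes f: "homogeneous d f" "dir_deriv q (dir_deriv q f) = 0" and den: "x * c - z * a \<noteq> 0"
  shows "eval f (x, y, z) = ((x * c - z * a) / c) ^ d *
    (poly (res f) (slope (x, y, z)) + z / (x * c - z * a) * poly (res (dir_deriv q f)) (slope (x, y, z)))"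
proof -
  let ?den = "x * c - z * a"
  let ?v = "(1, slope (x, y, z), 0) :: complex \<times> complex \<times> complex"
  have "(x, y, z) = scale3 (?den / c) (?v + scale3 (z / ?den) q)"
  proof -
    have h: "D / c * (t / D) = t / c" if "D \<noteq> 0" for D t
      using that by simp
    have "?den / c * slope (x, y, z) = y - z * b / c"
      unfolding slope.simps h[OF den] using ac_nz by (simp add: diff_divide_distrib)
    moreover have "?den / c * (z / ?den) = z / c"
      by (rule h[OF den])
    moreover have "?den / c = x - z * a / c"
      using ac_nz by (simp add: diff_divide_distrib)
    ultimately have "scale3 (?den / c) (?v + scale3 (z / ?den) q) = (x - z * a / c + z / c * a, y - z * b / c + z / c * b, z / c * c)"
      by (simp only: scale3.simps plus_prod_def fst_conv snd_conv distrib_left mult.assoc[symmetric] mult_1_right add_0)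
    then show ?thesis using ac_nz by simp
  qed
  then show ?thesis
    using homogeneous_eval_scale[OF f(1), of "?den / c" "?v + scale3 (z / ?den) q"]
      eval_line_affine[OF f(2), of ?v "z / ?den"] by simp
qed

text \<open>The chart (1, slope, 0) misses only the direction from \<open>q\<close> towards (0:1:0);
  the avoided lines ensure that no point of the configuration is seen in that direction.\<close>

lemma den_nz:
  assumes "(x, y, z) \<in> linecoeffs m"
  shows "x * c - z * a \<noteq> 0"
proof -
  have "\<zeta> * c + a \<noteq> 0" if "\<zeta> ^ m = 1" for \<zeta>
  proof
    assume z: "\<zeta> * c + a = 0"
    have "\<zeta> \<noteq> 0" using that m3 by (auto simp: power_0_left)
    then have "(1 / \<zeta>) * a + c = 0" using z by (simp add: field_simps)
    moreover have "(1 / \<zeta>) ^ m = 1" using that by (simp add: power_divide)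
    ultimately show False using root_nz by blast
  qed
  moreover have "\<zeta> \<noteq> 0" if "\<zeta> ^ m = 1" for \<zeta> :: complex using that m3 by (auto simp: power_0_left)
  moreover have "(x = 1 \<and> z = 0) \<or> (\<exists>\<zeta>. \<zeta> ^ m = 1 \<and> (x = 0 \<and> z = - \<zeta> \<or> x = - \<zeta> \<and> z = 1))"
    using assms by (auto simp: linecoeffs_def)
  moreover have "- \<zeta> * c - 1 * a = - (\<zeta> * c + a)" for \<zeta> by simp
  ultimately show ?thesis
    using ac_nz by (elim disjE exE conjE) (simp_all only: neg_equal_0_iff_equal, simp_all)
qed

lemma eval_0_res:
  assumes "homogeneous d f" "dir_deriv q (dir_deriv q f) = 0" "(x, y, z) \<in> linecoeffs m" "eval f (x, y, z) = 0"
  shows "poly (res f) (slope (x, y, z)) = - (z / (x * c - z * a)) * poly (res (dir_deriv q f)) (slope (x, y, z))"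
  using eval_via_res[OF assms(1,2) den_nz[OF assms(3)], of y] assms(4) den_nz[OF assms(3)] ac_nz
  by (auto simp: eq_neg_iff_add_eq_0)

text \<open>Equal slopes make the two points collinear with \<open>q\<close>, that is, their triple
  product with \<open>q\<close> vanishes.\<close>

lemma inj_slope: "inj_on slope (linecoeffs m)"
proof (rule inj_onI, rule ccontr)
  fix p p' assume p: "p \<in> linecoeffs m" "p' \<in> linecoeffs m" "slope p = slope p'" "p \<noteq> p'"
  obtain x y z where xyz: "p = (x, y, z)" by (cases p)
  obtain x' y' z' where xyz': "p' = (x', y', z')" by (cases p')
  have "(y * c - z * b) * (x' * c - z' * a) = (y' * c - z' * b) * (x * c - z * a)"
    using p den_nz[of x y z] den_nz[of x' y' z'] by (simp add: xyz xyz' field_simps)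
  then have "c * dot3 (cross3 p p') q = 0"
    by (simp add: xyz xyz' algebra_simps)
  moreover have "cross3 p p' \<in> avoided_lines m"
    using p by (force simp: avoided_lines_def)
  ultimately show False using generic ac_nz by simp
qed

text \<open>The expansion is available off the line xc = za; multiplying by the form of this line
  gives an identity at all points, and the form cancels.\<close>

lemma eq_0_if_res:
  assumes "homogeneous d f" "dir_deriv q (dir_deriv q f) = 0" "res f = 0" "res (dir_deriv q f) = 0"
  shows "f = 0"
proof -
  have "f * linf (c, 0, - a) = 0"
  proof (rule eval_ext)
    fix v :: "complex \<times> complex \<times> complex"
    obtain x y z where v: "v = (x, y, z)" by (cases v)
    have "eval f v = 0" if "x * c - z * a \<noteq> 0"
      using eval_via_res[OF assms(1,2) that, of y] assms(3,4) unfolding v by simp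
    then show "eval (f * linf (c, 0, - a)) v = eval 0 v"
      by (auto simp: v algebra_simps)
  qed
  then show ?thesis using ac_nz by (auto simp: zero_prod_def)
qed

lemma res_linf: "res (linf (x, y, z)) = [:x, y:]"
  unfolding res_def by (rule line_poly_eqI) (simp add: algebra_simps)

text \<open>The leading coefficient is ac(c^m - (-a)^m), nonzero because \<open>q\<close> avoids the
  lines (\<zeta>, 0, 1) and the two coordinate lines. The exact degree is what makes the
  divisibility in the elimination contradictory.\<close>

lemma degree_res_dir_deriv_unexpected_curve: "degree (res (dir_deriv q (unexpected_curve m q))) = m + 1"
proof -
  have r: "res (const t * linf l ^ n) = smult t (res (linf l) ^ n)" for t l n
    by (simp add: res_def)
  have top: "coeff ([:s, t:] ^ n) n = t ^ n" for s t :: complex and n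
  proof (cases "t = 0")
    case True
    then show ?thesis by (cases n) (auto simp: coeff_eq_0 degree_power_eq poly_const_pow)
  next
    case False
    then have "degree ([:s, t:] ^ n) = n" by (simp add: degree_power_eq)
    then show ?thesis using lead_coeff_power[of "[:s, t:]" n] False by simp
  qed
  have "res (dir_deriv q (unexpected_curve m q)) =
      smult a ([:0, c:] ^ (m + 1)) + smult b ([:- c, 0:] ^ (m + 1)) + smult c ([:b, - a:] ^ (m + 1))"
    unfolding dir_deriv_unexpected_curve by (simp add: res_def del: power_Suc) (simp add: r res_linf flip: res_def del: power_Suc)
  then have "coeff (res (dir_deriv q (unexpected_curve m q))) (m + 1) = a * c ^ (m + 1) + b * 0 ^ (m + 1) + c * (- a) ^ (m + 1)"
    by (simp only: coeff_add coeff_smult top)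
  also have "\<dots> = a * c * (c ^ m - (- a) ^ m)"
    by (simp add: algebra_simps)
  also have "\<dots> \<noteq> 0"
  proof
    assume "a * c * (c ^ m - (- a) ^ m) = 0"
    then have "c ^ m = (- a) ^ m" using ac_nz by simp
    then obtain \<zeta> where "\<zeta> ^ m = 1" "c = \<zeta> * - a" using power_eq_iff_root[of m c "- a"] m3 by auto
    then show False using root_nz[of \<zeta>] by simp
  qed
  finally have "m + 1 \<le> degree (res (dir_deriv q (unexpected_curve m q)))" by (rule le_degree)
  moreover have "degree (res (dir_deriv q (unexpected_curve m q))) \<le> m + 2 - 1"
    by (intro degree_res homogeneous_dir_deriv homogeneous_unexpected_curve)
  ultimately show ?thesis by simp
qed

text \<open>With p = (1, s, 0) and v = p x q, both v and \<theta>(v) are orthogonal to p and q,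
  hence proportional. So the nonzero coordinates of v have equal m-th powers, and q . v = 0 is
  excluded for such v by the choice of \<open>q\<close>.\<close>

lemma unexpected_curve_no_common_root:
  assumes g: "poly (res (unexpected_curve m q)) s = 0" and B: "poly (res (dir_deriv q (unexpected_curve m q))) s = 0"
  shows False
proof -
  \<comment> \<open>The vector (\<open>x1\<close>, \<open>e\<close>, \<open>x3\<close>) is p x q;
    its middle coordinate is nonzero and serves for normalization.\<close>
  define e x1 x3 where "e = - c" and "x1 = s * c" and "x3 = b - s * a"
  have e: "e \<noteq> 0" using ac_nz by (simp add: e_def)
  have s: "s * e = - x1" by (simp add: e_def x1_def)
  have "x1 ^ (m + 1) + s * e ^ (m + 1) = 0"
    using g by (simp add: unexpected_curve_def e_def x1_def mult.commute[of s c] del: power_Suc)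
  have "x1 * (x1 ^ m - e ^ m) = 0"
  proof -
    note \<open>x1 ^ (m + 1) + s * e ^ (m + 1) = 0\<close>
    moreover have "s * e ^ (m + 1) = (s * e) * e ^ m" by simp
    ultimately show ?thesis unfolding s by (simp add: algebra_simps)
  qed
  then have x1: "x1 = 0 \<or> x1 ^ m = e ^ m" and x1': "x1 ^ (m + 1) = x1 * e ^ m"
    by (auto simp: algebra_simps)
  have orth: "a * x1 + b * e + c * x3 = 0"
    by (simp add: x1_def e_def x3_def algebra_simps)
  have "a * x1 ^ (m + 1) + b * e ^ (m + 1) + c * x3 ^ (m + 1) = 0"
    using B unfolding dir_deriv_unexpected_curve by (simp add: e_def x1_def x3_def algebra_simps del: power_Suc)
  then have "a * (x1 * e ^ m) + b * (e * e ^ m) + c * x3 ^ (m + 1) = 0"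
    unfolding x1' by simp
  then have "(a * x1 + b * e) * e ^ m + c * x3 ^ (m + 1) = 0"
    by (simp only: distrib_right mult.assoc)
  moreover have "a * x1 + b * e = - (c * x3)"
    using orth by (simp add: eq_neg_iff_add_eq_0)
  ultimately have "c * (x3 * (x3 ^ m - e ^ m)) = 0"
    by (simp add: algebra_simps)
  then have x3: "x3 = 0 \<or> x3 ^ m = e ^ m" using ac_nz by auto
  have "x1 / e = 0 \<or> (x1 / e) ^ m = 1" "x3 / e = 0 \<or> (x3 / e) ^ m = 1"
    using x1 x3 e by (auto simp: power_divide)
  then have "x1 / e * a + b + x3 / e * c \<noteq> 0" by (rule roots_nz)
  moreover have "x1 / e * a + b + x3 / e * c = (a * x1 + b * e + c * x3) / e"
    using e by (simp add: add_divide_distrib mult.commute)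
  ultimately show False unfolding orth by simp
qed

lemma unexpected_curve_coprime: "coprime (res (dir_deriv q (unexpected_curve m q))) (res (unexpected_curve m q))"
proof (rule coprimeI)
  fix d assume d: "d dvd res (dir_deriv q (unexpected_curve m q))" "d dvd res (unexpected_curve m q)"
  have "degree d = 0"
  proof (rule ccontr)
    assume "degree d \<noteq> 0"
    then have "\<not> constant (poly d)" by (simp add: constant_degree)
    then obtain s where "poly d s = 0" using fundamental_theorem_of_algebra by blast
    then have "poly (res (dir_deriv q (unexpected_curve m q))) s = 0" "poly (res (unexpected_curve m q)) s = 0"
      using d by (auto simp only: dvd_def poly_mult mult_zero_left)
    then show False using unexpected_curve_no_common_root by blast
  qed
  moreover have "d \<noteq> 0"
    using d degree_res_dir_deriv_unexpected_curve by auto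
  ultimately show "is_unit d" by (simp add: is_unit_iff_degree)
qed

lemma unexpected_curve_nz: "unexpected_curve m q \<noteq> 0"
  using degree_res_dir_deriv_unexpected_curve by (auto simp: res_def)

text \<open>On the pencil of lines through \<open>q\<close>, \<open>h\<close> and the unexpected curve become binary forms that are
  affine in the position along the line. Eliminating the position leaves a binary form with too
  many zeros, and coprimality with the unexpected curve forces \<open>h = 0\<close>.\<close>

lemma too_many_points:
  assumes h: "homogeneous d h" "dir_deriv q (dir_deriv q h) = 0" and d: "1 \<le> d" "d \<le> m + 1"
    and T: "T \<subseteq> linecoeffs m" "\<And>p. p \<in> T \<Longrightarrow> eval h p = 0" "card T > d + m + 1"
  shows "h = 0"
proof -
  let ?g = "unexpected_curve m q"
  \<comment> \<open>The eliminant of two expressions affine in the same parameter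
    \<open>z / (x * c - z * a)\<close>; it vanishes at the slope of every common zero.\<close>
  let ?R = "res h * res (dir_deriv q ?g) - res (dir_deriv q h) * res ?g"
  have deg: "degree (res h) \<le> d" "degree (res (dir_deriv q ?g)) \<le> m + 1" "degree (res (dir_deriv q h)) \<le> d - 1" "degree (res ?g) \<le> m + 2"
    using degree_res[OF h(1)] degree_res_dir_deriv_unexpected_curve degree_res[OF homogeneous_dir_deriv[OF h(1)]]
      degree_res[OF homogeneous_unexpected_curve] by auto
  have "degree (res h * res (dir_deriv q ?g)) \<le> d + m + 1" "degree (res (dir_deriv q h) * res ?g) \<le> d + m + 1"
    using degree_mult_le[of "res h" "res (dir_deriv q ?g)"] degree_mult_le[of "res (dir_deriv q h)" "res ?g"] deg d by linarith+
  then have "degree ?R \<le> d + m + 1" by (rule degree_diff_le)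
  moreover have "slope ` T \<subseteq> {s. poly ?R s = 0}"
  proof
    fix s assume "s \<in> slope ` T"
    then obtain x y z where p: "(x, y, z) \<in> T" "s = slope (x, y, z)" by auto
    then have "(x, y, z) \<in> linecoeffs m" using T by blast
    then have "poly (res h) s = - (z / (x * c - z * a)) * poly (res (dir_deriv q h)) s"
      "poly (res ?g) s = - (z / (x * c - z * a)) * poly (res (dir_deriv q ?g)) s"
      using p T(2) eval_0_res[OF h] eval_0_res[OF homogeneous_unexpected_curve dir_deriv2_unexpected_curve] unexpected_curve_through m3
      by auto
    then show "s \<in> {s. poly ?R s = 0}" by (simp del: poly_res)
  qed
  moreover have "card (slope ` T) = card T"
    by (rule card_image) (rule inj_on_subset[OF inj_slope T(1)])
  ultimately have R: "?R = 0"
    using T(3) card_poly_roots_bound[of ?R] card_mono[OF poly_roots_finite[of ?R], of "slope ` T"] by fastforce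
  then have "res (dir_deriv q ?g) dvd res (dir_deriv q h) * res ?g"
    by (metis dvd_triv_right eq_iff_diff_eq_0)
  then have dv: "res (dir_deriv q ?g) dvd res (dir_deriv q h)"
    using coprime_dvd_mult_left_iff[OF unexpected_curve_coprime] by blast
  \<comment> \<open>Its divisor has degree m + 1, while its own degree is at most d - 1 \<le>
    m.\<close>
  have "res (dir_deriv q h) = 0"
    using dvd_imp_degree_le[OF dv] degree_res_dir_deriv_unexpected_curve deg d by linarith
  moreover from this have "res h = 0"
    using R degree_res_dir_deriv_unexpected_curve by auto
  ultimately show ?thesis
    using eq_0_if_res[OF h] by blast
qed

lemma forms_through_multD:
  assumes "f \<in> forms_through_mult (pt ` linecoeffs m) j (j - 1) (pt q)"
  shows "homogeneous j f" "dir_deriv q (dir_deriv q f) = 0" "\<And>p. p \<in> linecoeffs m \<Longrightarrow> eval f p = 0"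
proof -
  have q: "q \<noteq> 0" using ac_nz by (auto simp: zero_prod_def)
  have f: "homogeneous j f" "\<And>p. p \<in> linecoeffs m \<Longrightarrow> vanishes_at f (pt p)" "vanishes_to_order (j - 1) f (pt q)"
    using assms by (auto simp: forms_through_mult_def forms_through_def)
  show "homogeneous j f" by fact
  have "vanish_order (j - 1) f q"
    using f(3) coords_pt_self[OF q] unfolding vanish_order_iff vanishes_to_order_def vanishes_at_def by blast
  then show "dir_deriv q (dir_deriv q f) = 0" using dir_deriv2_eq_0 f by blast
  show "eval f p = 0" if "p \<in> linecoeffs m" for p
  proof -
    have "p \<noteq> 0" using that by auto
    then show ?thesis using f(2)[OF that] coords_pt_self unfolding vanishes_at_def by blast
  qed
qed

text \<open>All 3m + 1 points are zeros, which exceeds j + m + 1 \<le> 2m + 2.\<close>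

lemma no_low_degree:
  assumes "f \<in> forms_through_mult (pt ` linecoeffs m) j (j - 1) (pt q)" "1 \<le> j" "j \<le> m + 1"
  shows "f = 0"
  using too_many_points[OF forms_through_multD(1,2)[OF assms(1)], of "linecoeffs m"]
    forms_through_multD(3)[OF assms(1)] assms m3 card_linecoeffs[of m] by auto

text \<open>A factor that is a cone over \<open>q\<close> is a union of lines through \<open>q\<close>, and each of these
  contains at most one point of the configuration.\<close>

lemma no_cone_factor:
  assumes f: "f = g * h" "f \<noteq> 0" "dir_deriv q (dir_deriv q f) = 0" "\<And>p. p \<in> linecoeffs m \<Longrightarrow> eval f p = 0"
    and gh: "homogeneous i g" "homogeneous k h" "i > 0" "k > 0" "i + k = m + 2"
    and cone: "dir_deriv q g = 0"
  shows False
proof -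
  let ?G = "{p \<in> linecoeffs m. eval g p = 0}" and ?H = "{p \<in> linecoeffs m. eval h p = 0}"
  have nz: "g \<noteq> 0" "h \<noteq> 0" using f by auto
  have g2: "dir_deriv q (dir_deriv q g) = 0" by (simp add: cone)
  have h2: "dir_deriv q (dir_deriv q h) = 0"
    using f(3) nz unfolding f(1) by (simp add: dir_deriv_mult dir_deriv_add cone)
  have "res g \<noteq> 0"
  proof
    assume "res g = 0"
    then show False using eq_0_if_res[OF gh(1) g2] nz cone by (simp add: res_def)
  qed
  moreover have "slope ` ?G \<subseteq> {s. poly (res g) s = 0}"
  proof
    fix s assume "s \<in> slope ` ?G"
    then obtain x y z where "(x, y, z) \<in> ?G" "s = slope (x, y, z)" by auto
    then show "s \<in> {s. poly (res g) s = 0}"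
      using eval_0_res[OF gh(1) g2] by (simp add: cone res_def)
  qed
  moreover have "card (slope ` ?G) = card ?G"
    by (rule card_image) (rule inj_on_subset[OF inj_slope], auto)
  ultimately have "card ?G \<le> i"
    using card_poly_roots_bound[of "res g"] card_mono[OF poly_roots_finite[of "res g"], of "slope ` ?G"]
      degree_res[OF gh(1)] by linarith
  moreover have "linecoeffs m = ?G \<union> ?H" using f by auto
  then have "3 * m + 1 \<le> card ?G + card ?H"
    using card_linecoeffs[of m] card_Un_le[of ?G ?H] m3 by simp
  \<comment> \<open>The cofactor keeps at least 3m + 1 - i = 2m - 1 + k points, and m \<ge> 3 makes
    this larger than k + m + 1.\<close>
  ultimately have card: "card ?H > k + m + 1" using gh m3 by linarith
  have "1 \<le> k" "k \<le> m + 1" using gh by linarith+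
  then have "h = 0"
    using too_many_points[OF gh(2) h2 _ _ _ _ card] by blast
  then show False using nz by simp
qed

lemma irreducible_minimal:
  assumes "f \<in> forms_through_mult (pt ` linecoeffs m) (m + 2) (m + 2 - 1) (pt q)" "f \<noteq> 0"
  shows "irreducible f"
proof (rule irreducible_homogeneousI[of _ "m + 2"])
  note f = forms_through_multD[OF assms(1)]
  show "homogeneous (m + 2) f" by (rule f)
  fix g h i k assume gh: "f = g * h" "homogeneous i g" "homogeneous k h" "i > 0" "k > 0" "i + k = m + 2"
  have "dir_deriv q g = 0 \<or> dir_deriv q h = 0"
    using f(2) unfolding gh(1) by (rule factor_constant_along)
  then show False
  proof
    assume *: "dir_deriv q g = 0"
    show False
      using no_cone_factor[OF gh(1) assms(2) f(2) _ gh(2-6) *] f(3) by blast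
  next
    assume *: "dir_deriv q h = 0"
    have "f = h * g" "k + i = m + 2" using gh by (simp_all add: mult.commute)
    then show False
      using no_cone_factor[OF _ assms(2) f(2) _ gh(3,2) gh(5,4) _ *] f(3) by blast
  qed
qed (rule assms(2), simp)

end

section \<open>Dimension counts\<close>

text \<open>Independence of an indexed family already gives injectivity, by testing the coefficients
  1 and -1. The finite spanning set makes bases of \<open>V\<close> finite, so that
  \<open>dim\<close> bounds the size of independent sets.\<close>

lemma card_le_dim:
  assumes I: "finite I" "h ` I \<subseteq> V" and T: "finite T" "V \<subseteq> S_vs.span T"
    and indep: "\<And>u i. (\<Sum>i\<in>I. const (u i) * h i) = 0 \<Longrightarrow> i \<in> I \<Longrightarrow> u i = 0"
  shows "card I \<le> S_vs.dim V"
proof -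
  have inj: "inj_on h I"
  proof (rule inj_onI, rule ccontr)
    fix i j assume ij: "i \<in> I" "j \<in> I" "h i = h j" "i \<noteq> j"
    let ?u = "\<lambda>k. (if k = i then 1 else 0) - (if k = j then 1 else 0) :: complex"
    have "(\<Sum>k\<in>I. const (?u k) * h k)
      = (\<Sum>k\<in>I. (if k = i then h k else 0) - (if k = j then h k else 0))"
      by (rule sum.cong) auto
    also have "\<dots> = h i - h j"
      using I(1) ij by (simp add: sum_subtractf)
    finally have "?u i = 0"
      using indep[of ?u i] ij by simp
    then show False using ij by simp
  qed
  have "S_vs.independent (h ` I)"
    unfolding S_vs.dependent_finite[OF finite_imageI[OF I(1)]]
  proof (intro notI, elim exE conjE)
    fix u assume u: "\<exists>v\<in>h ` I. u v \<noteq> 0" "(\<Sum>v\<in>h ` I. const (u v) * v) = 0"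
    then have "(\<Sum>i\<in>I. const (u (h i)) * h i) = 0"
      by (simp add: sum.reindex[OF inj])
    then show False using indep[of "\<lambda>i. u (h i)"] u(1) by blast
  qed
  moreover obtain B where B: "B \<subseteq> V" "S_vs.independent B" "V \<subseteq> S_vs.span B" "card B = S_vs.dim V"
    by (rule S_vs.basis_exists)
  moreover have "finite B"
    using S_vs.independent_span_bound[OF T(1) B(2)] B(1) T(2) by blast
  moreover have "h ` I \<subseteq> S_vs.span B" using I(2) B(3) by blast
  ultimately have "card (h ` I) \<le> card B"
    using S_vs.independent_span_bound by blast
  then show ?thesis using B card_image[OF inj] by simp
qed

lemma homogeneous_in_span: "{f. homogeneous d f} \<subseteq> S_vs.span (mono3 d ` mono_index d)"
proof
  fix f assume "f \<in> {f. homogeneous d f}"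
  then have "f = (\<Sum>(a, b)\<in>mono_index d. const (monom_coeff f a b (d - a - b)) * mono3 d (a, b))"
    using homogeneous_expand by simp
  also have "\<dots> \<in> S_vs.span (mono3 d ` mono_index d)"
    by (rule S_vs.span_sum) (clarify, rule S_vs.span_scale, rule S_vs.span_base, rule imageI)
  finally show "f \<in> S_vs.span (mono3 d ` mono_index d)" .
qed

text \<open>The configuration consists of m points on each side of the coordinate triangle, off its
  vertices, and of the vertex (1:0:0). For a point on a side, m - 1 lines through the opposite
  vertex kill the others on that side, and the other two sides kill the rest. The vertex needs a
  form of its own.\<close>

lemma separating_form_minimal:
  assumes m: "m \<ge> 1" and p: "p \<in> linecoeffs m"
  shows "\<exists>e. homogeneous (m + 1) e \<and> eval e p \<noteq> 0 \<and> (\<forall>p'\<in>linecoeffs m - {p}. eval e p' = 0)"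
proof -
  define U where "U = {\<zeta>::complex. \<zeta> ^ m = 1}"
  have U: "finite U" "card U = m" "0 \<notin> U"
    using m by (auto simp: U_def intro: finite_roots_unity simp: card_roots_unity_eq power_0_left)
  have lc: "linecoeffs m = insert (1, 0, 0) ((\<lambda>\<zeta>. (1, - \<zeta>, 0)) ` U \<union>
     (\<lambda>\<zeta>. (0, 1, - \<zeta>)) ` U \<union> (\<lambda>\<zeta>. (- \<zeta>, 0, 1)) ` U)"
    unfolding linecoeffs_def U_def ..
  have hom: "homogeneous (m + 1) ((\<Prod>\<zeta>'\<in>U - {\<zeta>}. linf (l \<zeta>')) * (f * g))"
    if "\<zeta> \<in> U" "homogeneous (Suc 0) f" "homogeneous (Suc 0) g" for \<zeta> l f g
  proof -
    have "homogeneous (\<Sum>\<zeta>'\<in>U - {\<zeta>}. Suc 0) (\<Prod>\<zeta>'\<in>U - {\<zeta>}. linf (l \<zeta>'))"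
      by (rule homogeneous_prod) simp
    then have "homogeneous ((\<Sum>\<zeta>'\<in>U - {\<zeta>}. Suc 0) + (Suc 0 + Suc 0)) ((\<Prod>\<zeta>'\<in>U - {\<zeta>}. linf (l \<zeta>')) * (f * g))"
      using that by (intro homogeneous_mult)
    moreover have "(\<Sum>\<zeta>'\<in>U - {\<zeta>}. Suc 0) + (Suc 0 + Suc 0) = m + 1"
      using that(1) U m by simp
    ultimately show ?thesis by metis
  qed
  have prod: "(\<Prod>i\<in>U - {\<zeta>}. i - \<zeta>') = 0 \<longleftrightarrow> \<zeta>' \<in> U \<and> \<zeta>' \<noteq> \<zeta>" for \<zeta> \<zeta>'
    using U(1) by auto
  consider "p = (1, 0, 0)" | \<zeta> where "\<zeta> \<in> U" "p = (1, - \<zeta>, 0)" | \<zeta> where "\<zeta> \<in> U" "p = (0, 1, - \<zeta>)"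
    | \<zeta> where "\<zeta> \<in> U" "p = (- \<zeta>, 0, 1)"
    using p unfolding lc by blast
  then show ?thesis
  proof cases
    case 1
    \<comment> \<open>The sign arises from (-\<zeta>)^m = (-1)^m, as the points have coordinates
      -\<zeta>.\<close>
    let ?k = "const ((- 1) ^ m)"
    let ?e = "X * (X ^ m - ?k * Y ^ m - ?k * Z ^ m)"
    have "homogeneous (Suc 0 + m) ?e"
      by (intro homogeneous_mult homogeneous_diff homogeneous_const_mult homogeneous_power1 homogeneous_gens)
    moreover have "(- \<zeta>) ^ m = (- 1) ^ m" if "\<zeta> \<in> U" for \<zeta>
      using that power_minus[of \<zeta> m] by (simp add: U_def)
    moreover have "((- 1) ^ m * (- 1) ^ m :: complex) = 1"
      by (simp flip: power_mult_distrib)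
    ultimately show ?thesis
      using m by (intro exI[of _ ?e]) (auto simp: 1 lc power_0_left)
  next
    case (2 \<zeta>)
    let ?e = "(\<Prod>\<zeta>'\<in>U - {\<zeta>}. linf (\<zeta>', 1, 0)) * (X * Y)"
    have "eval ?e p \<noteq> 0"
      using 2 U(3) by (auto simp: prod)
    moreover have "eval ?e p' = 0" if "p' \<in> linecoeffs m - {p}" for p'
      using that unfolding lc 2(2) by (auto simp: prod)
    ultimately show ?thesis using hom[OF 2(1) homogeneous_gens(1,2), of "\<lambda>\<zeta>'. (\<zeta>', 1, 0)"] by blast
  next
    case (3 \<zeta>)
    let ?e = "(\<Prod>\<zeta>'\<in>U - {\<zeta>}. linf (0, \<zeta>', 1)) * (Y * Z)"
    have "eval ?e p \<noteq> 0"
      using 3 U(3) by (auto simp: prod)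
    moreover have "eval ?e p' = 0" if "p' \<in> linecoeffs m - {p}" for p'
      using that unfolding lc 3(2) by (auto simp: prod)
    ultimately show ?thesis using hom[OF 3(1) homogeneous_gens(2,3), of "\<lambda>\<zeta>'. (0, \<zeta>', 1)"] by blast
  next
    case (4 \<zeta>)
    let ?e = "(\<Prod>\<zeta>'\<in>U - {\<zeta>}. linf (1, 0, \<zeta>')) * (Z * X)"
    have "eval ?e p \<noteq> 0"
      using 4 U(3) by (auto simp: prod)
    moreover have "eval ?e p' = 0" if "p' \<in> linecoeffs m - {p}" for p'
      using that unfolding lc 4(2) by (auto simp: prod)
    ultimately show ?thesis using hom[OF 4(1) homogeneous_gens(3,1), of "\<lambda>\<zeta>'. (1, 0, \<zeta>')"] by blast
  qed
qed

lemma dot3_commute: "dot3 u v = dot3 v u"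
  by (cases u; cases v) (simp add: mult.commute)

lemma separating_form:
  assumes m: "m \<ge> 1" and p: "p \<in> linecoeffs m" and j: "j \<ge> m + 1"
  shows "\<exists>e. homogeneous j e \<and> eval e p \<noteq> 0 \<and> (\<forall>p'\<in>linecoeffs m - {p}. eval e p' = 0)"
proof -
  obtain e where e: "homogeneous (m + 1) e" "eval e p \<noteq> 0" "\<forall>p'\<in>linecoeffs m - {p}. eval e p' = 0"
    using separating_form_minimal[OF m p] by blast
  have "p \<noteq> 0" using p by auto
  then obtain l where l: "dot3 l p \<noteq> 0"
    using avoid_lines[of "{p}"] dot3_commute by (metis empty_iff finite.emptyI finite.insertI insert_iff)
  have "homogeneous (j - (m + 1) + (m + 1)) (linf l ^ (j - (m + 1)) * e)"
    using e by (intro homogeneous_mult homogeneous_power1 homogeneous_linf)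
  then have "homogeneous j (linf l ^ (j - (m + 1)) * e)" using j by simp
  moreover have "eval (linf l ^ (j - (m + 1)) * e) p \<noteq> 0" using e l by simp
  moreover have "\<forall>p'\<in>linecoeffs m - {p}. eval (linf l ^ (j - (m + 1)) * e) p' = 0" using e by simp
  ultimately show ?thesis by blast
qed

text \<open>A basis of the forms through the points stays independent after adding one separating
  form per point: evaluation at \<open>p\<close> isolates the coefficient of the form belonging to
  \<open>p\<close>. The total is bounded by the number of monomials.\<close>

lemma dim_forms_through:
  assumes m: "m \<ge> 1" and j: "j \<ge> m + 1"
  shows "S_vs.dim (forms_through (pt ` linecoeffs m) j) + (3 * m + 1) \<le> (j + 2) choose 2"
proof -
  let ?V = "forms_through (pt ` linecoeffs m) j" and ?T = "mono3 j ` mono_index j"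
  obtain B where B: "B \<subseteq> ?V" "S_vs.independent B" "?V \<subseteq> S_vs.span B" "card B = S_vs.dim ?V"
    by (rule S_vs.basis_exists)
  have V: "?V \<subseteq> {f. homogeneous j f}" by (auto simp: forms_through_def)
  have T: "finite ?T" by simp
  have "finite B"
    using S_vs.independent_span_bound[OF T B(2)] B(1) V homogeneous_in_span[of j] by blast
  have vanish: "eval f p = 0" if "f \<in> B" "p \<in> linecoeffs m" for f p
  proof -
    have "p \<noteq> 0" using that by auto
    then show ?thesis
      using that B(1) coords_pt_self unfolding forms_through_def vanishes_at_def by blast
  qed
  have "\<forall>p\<in>linecoeffs m. \<exists>e. homogeneous j e \<and> eval e p \<noteq> 0 \<and> (\<forall>p'\<in>linecoeffs m - {p}. eval e p' = 0)"
    using separating_form[OF m _ j] by blast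
  from bchoice[OF this] obtain e where ex: "\<forall>p\<in>linecoeffs m. homogeneous j (e p) \<and> eval (e p) p \<noteq> 0 \<and> (\<forall>p'\<in>linecoeffs m - {p}. eval (e p) p' = 0)" ..
  then have e: "homogeneous j (e p)" "eval (e p) p \<noteq> 0" "\<And>p'. p' \<in> linecoeffs m \<Longrightarrow> p' \<noteq> p \<Longrightarrow> eval (e p) p' = 0"
    if "p \<in> linecoeffs m" for p
    using that by blast+
  let ?I = "B <+> linecoeffs m" and ?h = "case_sum (\<lambda>f. f) e"
  have fin: "finite (linecoeffs m)" using m by simp
  have "card ?I \<le> S_vs.dim {f. homogeneous j f}"
  proof (rule card_le_dim[OF _ _ T homogeneous_in_span])
    show "finite ?I" using \<open>finite B\<close> fin by simp
    show "?h ` ?I \<subseteq> {f. homogeneous j f}"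
      using B(1) V e(1) by auto
    fix u i assume sum: "(\<Sum>i\<in>?I. const (u i) * ?h i) = 0" and i: "i \<in> ?I"
    have s: "(\<Sum>f\<in>B. const (u (Inl f)) * f) + (\<Sum>p\<in>linecoeffs m. const (u (Inr p)) * e p) = 0"
      using sum \<open>finite B\<close> fin by (simp add: sum.Plus)
    have r: "u (Inr p) = 0" if p: "p \<in> linecoeffs m" for p
    proof -
      have "0 = eval ((\<Sum>f\<in>B. const (u (Inl f)) * f) + (\<Sum>p\<in>linecoeffs m. const (u (Inr p)) * e p)) p"
        unfolding s by simp
      also have "\<dots> = (\<Sum>p'\<in>linecoeffs m. u (Inr p') * eval (e p') p)"
        using vanish p by simp
      also have "\<dots> = (\<Sum>p'\<in>linecoeffs m. if p' = p then u (Inr p) * eval (e p) p else 0)"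
        by (rule sum.cong) (use e(3) p in \<open>auto simp del: split_paired_All\<close>)
      also have "\<dots> = u (Inr p) * eval (e p) p"
        using p fin by simp
      finally show ?thesis using e(2) p by simp
    qed
    then have "(\<Sum>f\<in>B. const (u (Inl f)) * f) = 0"
      using s by simp
    then have "u (Inl f) = 0" if "f \<in> B" for f
      using S_vs.independentD[OF B(2) \<open>finite B\<close> subset_refl, of "\<lambda>f. u (Inl f)"] that by blast
    then show "u i = 0" using r i by blast
  qed
  also have "\<dots> \<le> card ?T"
    by (rule S_vs.dim_le_card[OF homogeneous_in_span T])
  also have "\<dots> \<le> (j + 2) choose 2"
    using card_image_le[OF finite_mono_index] card_mono_index by metis
  finally show ?thesis
    using \<open>finite B\<close> fin B(4) card_linecoeffs[OF m] by (simp add: card_Plus)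
qed

lemma choose_two_add_2: "(j + 2) choose 2 = (j choose 2) + 2 * j + 1"
  by (simp add: numeral_2_eq_2)

context generic_point
begin

text \<open>The k + 1 = j - m - 1 monomials of degree k in two independent linear forms vanishing at
  \<open>q\<close> supply the missing degree and the missing multiplicity at once.\<close>

lemma dim_forms_through_mult:
  assumes j: "j \<ge> m + 2"
  shows "j - m - 1 \<le> S_vs.dim (forms_through_mult (pt ` linecoeffs m) j (j - 1) (pt q))"
proof -
  define k where "k = j - (m + 2)"
  define h where "h = (\<lambda>i. linf (- c, 0, a) ^ i * (linf (0, c, - b) ^ (k - i) * unexpected_curve m q))"
  have q: "q \<noteq> 0" using ac_nz by (auto simp: zero_prod_def)
  have "card {..k} \<le> S_vs.dim (forms_through_mult (pt ` linecoeffs m) j (j - 1) (pt q))"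
  proof (rule card_le_dim[of _ h _ "mono3 j ` mono_index j"])
    show "h ` {..k} \<subseteq> forms_through_mult (pt ` linecoeffs m) j (j - 1) (pt q)"
    proof (rule image_subsetI)
      fix i assume "i \<in> {..k}"
      then have i: "i + (k - i + (m + 2)) = j" "i + (k - i + (m + 1)) = j - 1"
        using j by (auto simp: k_def)
      have hom: "homogeneous j (h i)"
        unfolding h_def i(1)[symmetric]
        by (intro homogeneous_mult homogeneous_power1 homogeneous_linf homogeneous_unexpected_curve)
      have "vanishes_at (h i) (pt p)" if p: "p \<in> linecoeffs m" for p
      proof -
        have "p \<noteq> 0" using p by auto
        moreover have "eval (h i) (scale3 t p) = 0" for t
          using unexpected_curve_through[OF _ p] m3 by (simp add: homogeneous_eval_scale[OF hom]) (simp add: h_def)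
        ultimately show ?thesis unfolding vanishes_at_def by (simp only: ball_coords_pt simp_thms)
      qed
      moreover have "vanish_order (j - 1) (h i) (scale3 t q)" for t
        unfolding h_def i(2)[symmetric]
        by (intro vanish_order_linf_power_mult vanish_order_unexpected_curve) simp_all
      then have "vanishes_to_order (j - 1) (h i) (pt q)"
        unfolding vanishes_to_order_def vanishes_at_def ball_coords_pt[OF q] vanish_order_iff by blast
      ultimately show "h i \<in> forms_through_mult (pt ` linecoeffs m) j (j - 1) (pt q)"
        using hom by (auto simp: forms_through_mult_def forms_through_def)
    qed
    show "forms_through_mult (pt ` linecoeffs m) j (j - 1) (pt q) \<subseteq> S_vs.span (mono3 j ` mono_index j)"
      using homogeneous_in_span[of j] by (auto simp: forms_through_mult_def forms_through_def)
    fix u i assume sum: "(\<Sum>i\<in>{..k}. const (u i) * h i) = 0" and i: "i \<in> {..k}"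
    have "(\<Sum>i\<in>{..k}. const (u i) * (linf (- c, 0, a) ^ i * linf (0, c, - b) ^ (k - i))) * unexpected_curve m q = 0"
      using sum by (simp add: h_def sum_distrib_right mult.assoc)
    then have z: "(\<Sum>i\<in>{..k}. const (u i) * (linf (- c, 0, a) ^ i * linf (0, c, - b) ^ (k - i))) = 0"
      using unexpected_curve_nz by simp
    have "poly (\<Sum>i\<in>{..k}. monom (u i) i) t = 0" for t
      \<comment> \<open>At this point the two linear forms take the values t and 1, which turns the
        relation into a polynomial in t.\<close>
      using arg_cong[OF z, of "\<lambda>f. eval f (- t / c, 1 / c, 0)"] ac_nz by (simp add: poly_sum poly_monom)
    then have "(\<Sum>i\<in>{..k}. monom (u i) i) = 0"
      using poly_all_0_iff_0 by blast
    then have "coeff (\<Sum>i\<in>{..k}. monom (u i) i) i = 0" by simp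
    then show "u i = 0" using i by (simp add: coeff_sum)
  qed simp_all
  then show ?thesis by (simp add: k_def)
qed

lemma unexpected:
  assumes j: "m + 2 \<le> j" "j \<le> 2 * m - 2"
  shows "int (S_vs.dim (forms_through_mult (pt ` linecoeffs m) j (j - 1) (pt q))) >
    max 0 (int (S_vs.dim (forms_through (pt ` linecoeffs m) j)) - int (j choose 2))"
  using dim_forms_through_mult[OF j(1)] dim_forms_through[of m j] m3 j unfolding choose_two_add_2 by linarith

end

section \<open>Passage from explicit generic points to generic statements\<close>

lemma generic_pointI:
  assumes "m \<ge> 3" "\<And>l. l \<in> avoided_lines m \<Longrightarrow> dot3 l v \<noteq> 0" "v = (a, b, c)"
  shows "generic_point m a b c"
  using assms by unfold_locales auto

lemma generically_if_generic_point:
  assumes m: "m \<ge> 3" and P: "\<And>a b c. generic_point m a b c \<Longrightarrow> P (pt (a, b, c))"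
  shows "generically P"
proof (rule genericallyI[OF finite_avoided_lines zero_notin_avoided_lines])
  fix v assume "\<And>l. l \<in> avoided_lines m \<Longrightarrow> dot3 l v \<noteq> 0"
  then show "P (pt v)"
    using P generic_pointI[OF m] by (cases v) blast
qed (use m in auto)

lemma admits_unexpected:
  assumes m: "m \<ge> 3" and j: "m + 2 \<le> j" "j \<le> 2 * m - 2"
  shows "admits_unexpected_curves (dual_points (A1 m)) j"
  unfolding admits_unexpected_curves_def dual_points_A1[OF order_trans[OF _ m], simplified]
  using m j generically_if_generic_point[OF m] generic_point.unexpected[OF _ j] by auto

lemma unexpected_degree_ge:
  assumes m: "m \<ge> 3" and adm: "admits_unexpected_curves (dual_points (A1 m)) j"
  shows "m + 2 \<le> j"
proof (rule ccontr)
  assume "\<not> m + 2 \<le> j"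
  then have j: "2 \<le> j" "j \<le> m + 1"
    using adm by (auto simp: admits_unexpected_curves_def)
  let ?Z = "pt ` linecoeffs m"
  have Z: "dual_points (A1 m) = ?Z" using dual_points_A1 m by simp
  have "generically (\<lambda>q. int (S_vs.dim (forms_through_mult ?Z j (j - 1) q)) >
       max 0 (int (S_vs.dim (forms_through ?Z j)) - int (j choose 2)))"
    using adm unfolding admits_unexpected_curves_def Z by blast
  from generically_meets_open[OF this finite_avoided_lines zero_notin_avoided_lines] m
  obtain v where v: "\<And>l. l \<in> avoided_lines m \<Longrightarrow> dot3 l v \<noteq> 0"
    and dim: "S_vs.dim (forms_through_mult ?Z j (j - 1) (pt v)) > 0"
    by (metis (no_types, lifting) max.strict_boundedE of_nat_0_less_iff order_trans one_le_numeral)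
  obtain a b c where abc: "v = (a, b, c)" by (cases v)
  interpret generic_point m a b c
    using generic_pointI[OF m v abc] .
  have "forms_through_mult ?Z j (j - 1) (pt q) \<subseteq> S_vs.span {}"
    using no_low_degree[of _ j] j by auto
  then have "S_vs.dim (forms_through_mult ?Z j (j - 1) (pt q)) \<le> card ({} :: S set)"
    by (rule S_vs.dim_le_card) simp
  then show False using dim abc by simp
qed

lemma minimal_irreducible:
  assumes m: "m \<ge> 3"
  shows "generically (\<lambda>q. \<forall>F. curve_Cq (dual_points (A1 m)) (m + 2) q F \<longrightarrow> irreducible F)"
  unfolding dual_points_A1[OF order_trans[OF _ m], simplified] curve_Cq_def
  by (rule generically_if_generic_point[OF m]) (use generic_point.irreducible_minimal in blast)

section \<open>Freeness\<close>

lemma const_dvd_cancel: "t \<noteq> 0 \<Longrightarrow> f dvd const t * g \<Longrightarrow> f dvd g"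
proof -
  assume t: "t \<noteq> 0" and dvd: "f dvd const t * g"
  have "f dvd const (1 / t) * (const t * g)" using dvd by (rule dvd_mult)
  moreover have "const (1 / t) * (const t * g) = g"
    using t const_simps(4)[of "1 / t" t] by (simp add: mult.assoc[symmetric] del: const_simps(4))
  ultimately show "f dvd g" by (simp only:)
qed

lemma linf_not_dvd:
  assumes "cross3 c c' \<noteq> 0"
  shows "\<not> linf c dvd linf c'"
proof
  assume "linf c dvd linf c'"
  then obtain k where k: "linf c' = linf c * k" by (elim dvdE)
  have "cross3 c' c \<noteq> 0"
    using assms by (cases c; cases c') (auto simp: zero_prod_def algebra_simps)
  then obtain w where "dot3 (cross3 c' c) w \<noteq> 0"
    using avoid_lines[of "{cross3 c' c}"] by auto
  then have "eval (linf c') (cross3 c w) \<noteq> 0" by (simp add: cross3_dot3)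
  then show False unfolding k by simp
qed

lemma coprime_linf:
  assumes "c \<noteq> 0" "cross3 c c' \<noteq> 0"
  shows "coprime (linf c) (linf c')"
  by (intro prime_elem_imp_coprime irreducible_imp_prime_elem irreducible_linf linf_not_dvd assms)

lemma prod_linf_dvd:
  assumes "finite C" "0 \<notin> C" "\<And>c c'. c \<in> C \<Longrightarrow> c' \<in> C \<Longrightarrow> c \<noteq> c' \<Longrightarrow> cross3 c c' \<noteq> 0"
    "\<And>c. c \<in> C \<Longrightarrow> linf c dvd f"
  shows "(\<Prod>c\<in>C. linf c) dvd f"
  using assms
proof (induction C rule: finite_induct)
  case (insert c C)
  have "coprime (linf c) (\<Prod>c\<in>C. linf c)"
  proof (rule prod_coprime_right)
    fix c' assume "c' \<in> C"
    moreover have "c \<noteq> 0" using insert.prems(1) by auto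
    moreover from \<open>c' \<in> C\<close> have "cross3 c c' \<noteq> 0"
      using insert.prems(2)[of c c'] insert.hyps by blast
    ultimately show "coprime (linf c) (linf c')" by (intro coprime_linf)
  qed
  moreover have "(\<Prod>c\<in>C. linf c) dvd f"
    using insert.prems by (intro insert.IH) blast+
  moreover have "linf c dvd f" using insert.prems by blast
  ultimately have "linf c * (\<Prod>c\<in>C. linf c) dvd f"
    by (intro divides_mult)
  then show ?case using insert.hyps by simp
qed simp

lemma linf_dvd_f1:
  assumes m: "m \<ge> 1" and c: "c \<in> linecoeffs m"
  shows "linf c dvd f1 m"
proof -
  have sub: "f - const \<zeta> * g dvd f ^ m - g ^ m" if "\<zeta> ^ m = 1" for f g :: S and \<zeta>
  proof -
    have "(const \<zeta> * g) ^ m = g ^ m"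
      using that const_simps(7)[of \<zeta> m] by (simp add: power_mult_distrib del: const_simps(7))
    then have "f ^ m - g ^ m = (f - const \<zeta> * g) * (\<Sum>i<m. (const \<zeta> * g) ^ (m - Suc i) * f ^ i)"
      using power_diff_sumr2[of f m "const \<zeta> * g"] by simp
    then show ?thesis by (rule dvdI)
  qed
  consider "c = (1, 0, 0)" | \<zeta> where "\<zeta> ^ m = 1" "c = (1, - \<zeta>, 0)" | \<zeta> where "\<zeta> ^ m = 1" "c = (0, 1, - \<zeta>)"
    | \<zeta> where "\<zeta> ^ m = 1" "c = (- \<zeta>, 0, 1)"
    using c unfolding linecoeffs_def by blast
  then show ?thesis
  proof cases
    case 1
    then show ?thesis by (simp add: linf_def f1_def mult.assoc)
  next
    case (2 \<zeta>)
    have "linf c = X - const \<zeta> * Y" by (simp add: linf_def 2)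
    then show ?thesis using sub[OF 2(1), of X Y] unfolding f1_def by simp
  next
    case (3 \<zeta>)
    have "linf c = Y - const \<zeta> * Z" by (simp add: linf_def 3)
    then show ?thesis using sub[OF 3(1), of Y Z] unfolding f1_def by simp
  next
    case (4 \<zeta>)
    have "linf c = Z - const \<zeta> * X" by (simp add: linf_def 4)
    then show ?thesis using sub[OF 4(1), of Z X] unfolding f1_def by simp
  qed
qed

lemma f1_nz: assumes "m \<ge> 1" shows "f1 m \<noteq> 0"
proof -
  obtain w where "\<forall>c\<in>linecoeffs m. dot3 c w \<noteq> 0"
    using avoid_lines[of "linecoeffs m"] assms by auto
  then have "eval (f1 m) w \<noteq> 0" using eval_f1_eq_0_iff assms by blast
  then show ?thesis by auto
qed

lemma homogeneous_f1: "homogeneous (3 * m + 1) (f1 m)"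
proof -
  have "homogeneous (Suc 0 + m + m + m) (f1 m)"
    unfolding f1_def by (intro homogeneous_mult homogeneous_diff homogeneous_power1 homogeneous_gens)
  then show ?thesis by (simp add: numeral_3_eq_3 add.assoc)
qed

text \<open>Pairwise coprime linear forms divide \<open>f1 m\<close> jointly, and both sides have
  degree 3m + 1, so the quotient is constant.\<close>

lemma f1_factor:
  assumes m: "m \<ge> 1"
  shows "\<exists>k. k \<noteq> 0 \<and> f1 m = const k * (\<Prod>c\<in>linecoeffs m. linf c)"
proof -
  let ?P = "\<Prod>c\<in>linecoeffs m. linf c"
  have "?P dvd f1 m"
    using m linecoeffs_cross3[OF m] linf_dvd_f1[OF m] by (intro prod_linf_dvd) auto
  then obtain h where h: "f1 m = h * ?P" by (metis dvdE mult.commute)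
  have "homogeneous (\<Sum>c\<in>linecoeffs m. Suc 0) ?P"
    by (rule homogeneous_prod) simp
  then have P: "homogeneous (3 * m + 1) ?P" using card_linecoeffs[OF m] by simp
  have nz: "h * ?P \<noteq> 0" using f1_nz[OF m] h by simp
  obtain a b where ab: "a + b = 3 * m + 1" "homogeneous a h" "homogeneous b ?P"
    using homogeneous_factors[OF _ nz] homogeneous_f1 h by metis
  then have "b = 3 * m + 1" using homogeneous_unique[OF _ ab(3) P] nz by auto
  then have "homogeneous 0 h" using ab by simp
  then obtain k where "h = const k" by (rule homogeneous_0E)
  moreover have "k \<noteq> 0" using nz calculation by auto
  ultimately show ?thesis using h by blast
qed

section \<open>Logarithmic derivations and determinants\<close>

fun vfield :: "S \<times> S \<times> S \<Rightarrow> S \<Rightarrow> S" where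
  "vfield (r, s, t) f = r * Dx f + s * Dy f + t * Dz f"

lemma vfield_mult: "vfield \<rho> (f * g) = vfield \<rho> f * g + f * vfield \<rho> g"
  by (cases \<rho>) (simp add: D_mult algebra_simps)

lemma AR_iff: "\<rho> \<in> AR f \<longleftrightarrow> vfield \<rho> f = 0"
  by (cases \<rho>) (simp add: AR_def)

lemma vfield_zero: "vfield 0 f = 0"
  by (simp add: zero_prod_def)

lemma vfield_add: "vfield (\<rho> + \<sigma>) f = vfield \<rho> f + vfield \<sigma> f"
  by (cases \<rho>; cases \<sigma>) (simp add: algebra_simps)

lemma vfield_smult3: "vfield (smult3 u \<rho>) f = u * vfield \<rho> f"
  by (cases \<rho>) (simp add: algebra_simps)

lemma vfield_diff: "vfield \<rho> (f - g) = vfield \<rho> f - vfield \<rho> g"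
  by (cases \<rho>) (simp add: algebra_simps)

lemma vfield_power: "vfield \<rho> (f ^ n) = of_nat n * f ^ (n - 1) * vfield \<rho> f"
  by (cases \<rho>) (simp add: D_power algebra_simps)

lemma vfield_gens: "vfield (r, s, t) X = r" "vfield (r, s, t) Y = s" "vfield (r, s, t) Z = t"
  by simp_all

text \<open>Since \<open>f1 m\<close> is squarefree, a derivation preserving its ideal preserves the
  ideal of each linear factor: in the product rule the cofactor is coprime to
  \<open>linf c\<close>.\<close>

lemma linf_dvd_vfield_linf:
  assumes m: "m \<ge> 1" and c: "c \<in> linecoeffs m" and r: "f1 m dvd vfield \<rho> (f1 m)"
  shows "linf c dvd vfield \<rho> (linf c)"
proof -
  obtain k where k: "k \<noteq> 0" "f1 m = const k * (\<Prod>c\<in>linecoeffs m. linf c)"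
    using f1_factor[OF m] by blast
  let ?h = "const k * (\<Prod>c'\<in>linecoeffs m - {c}. linf c')"
  have f: "f1 m = linf c * ?h"
    using k(2) c m by (simp add: prod.remove[of _ c] algebra_simps)
  have "coprime (linf c) (\<Prod>c'\<in>linecoeffs m - {c}. linf c')"
  proof (rule prod_coprime_right)
    fix c' assume c': "c' \<in> linecoeffs m - {c}"
    moreover have "c \<noteq> 0" using c by auto
    moreover have "cross3 c c' \<noteq> 0"
      using linecoeffs_cross3[OF m c, of c'] c' by blast
    ultimately show "coprime (linf c) (linf c')" by (intro coprime_linf)
  qed
  moreover have "coprime (linf c) (const k)"
    using is_unit_right_imp_coprime homogeneous_0_unit[of "const k"] k(1) by simp
  ultimately have cop: "coprime (linf c) ?h" by (simp only: coprime_mult_right_iff)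
  have "linf c dvd vfield \<rho> (f1 m)"
    by (rule dvd_trans[OF linf_dvd_f1[OF m c] r])
  moreover have "vfield \<rho> (f1 m) = vfield \<rho> (linf c) * ?h + linf c * vfield \<rho> ?h"
    by (simp only: f vfield_mult)
  ultimately have "linf c dvd vfield \<rho> (linf c) * ?h"
    by (simp only: dvd_add_left_iff dvd_triv_left)
  then show ?thesis using coprime_dvd_mult_left_iff[OF cop] by blast
qed

fun det3 :: "S \<times> S \<times> S \<Rightarrow> S \<times> S \<times> S \<Rightarrow> S \<times> S \<times> S \<Rightarrow> S" where
  "det3 (a1, a2, a3) (b1, b2, b3) (c1, c2, c3) =
    a1 * (b2 * c3 - b3 * c2) + a2 * (b3 * c1 - b1 * c3) + a3 * (b1 * c2 - b2 * c1)"

text \<open>Easy half of Saito's criterion: modulo a linear factor of \<open>f1 m\<close> the three rows have a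
  common kernel vector.\<close>

lemma f1_dvd_det3:
  assumes m: "m \<ge> 1" and r: "\<And>\<rho>. \<rho> \<in> {A, B, C} \<Longrightarrow> f1 m dvd vfield \<rho> (f1 m)"
  shows "f1 m dvd det3 A B C"
proof -
  have "linf c dvd det3 A B C" if c: "c \<in> linecoeffs m" for c
  proof -
    obtain x y z where xyz: "c = (x, y, z)" by (cases c)
    obtain a1 a2 a3 where A: "A = (a1, a2, a3)" by (cases A)
    obtain b1 b2 b3 where B: "B = (b1, b2, b3)" by (cases B)
    obtain c1 c2 c3 where C: "C = (c1, c2, c3)" by (cases C)
    have d: "linf c dvd vfield A (linf c)" "linf c dvd vfield B (linf c)" "linf c dvd vfield C (linf c)"
      by (rule linf_dvd_vfield_linf[OF m c r]; simp)+
    \<comment> \<open>Replacing a column by the values of the rows on \<open>linf c\<close>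
      multiplies the determinant by a coordinate of \<open>c\<close>; these are the expansions along
      the new column.\<close>
    have "const x * det3 A B C = vfield A (linf c) * (b2 * c3 - b3 * c2)
      + vfield B (linf c) * (c2 * a3 - c3 * a2) + vfield C (linf c) * (a2 * b3 - a3 * b2)"
      "const y * det3 A B C = vfield A (linf c) * (b3 * c1 - b1 * c3)
      + vfield B (linf c) * (c3 * a1 - c1 * a3) + vfield C (linf c) * (a3 * b1 - a1 * b3)"
      "const z * det3 A B C = vfield A (linf c) * (b1 * c2 - b2 * c1)
      + vfield B (linf c) * (c1 * a2 - c2 * a1) + vfield C (linf c) * (a1 * b2 - a2 * b1)"
      by (simp_all add: A B C xyz algebra_simps)
    then have "linf c dvd const x * det3 A B C" "linf c dvd const y * det3 A B C" "linf c dvd const z * det3 A B C"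
      using d by (metis dvd_add dvd_mult2)+
    moreover have "c \<noteq> 0" using c zero_notin_linecoeffs by metis
    then have "x \<noteq> 0 \<or> y \<noteq> 0 \<or> z \<noteq> 0" by (auto simp: xyz zero_prod_def)
    ultimately show ?thesis using const_dvd_cancel by blast
  qed
  then have "(\<Prod>c\<in>linecoeffs m. linf c) dvd det3 A B C"
    using m linecoeffs_cross3[OF m] by (intro prod_linf_dvd) auto
  moreover obtain k where k: "k \<noteq> 0" "f1 m = const k * (\<Prod>c\<in>linecoeffs m. linf c)"
    using f1_factor[OF m] by blast
  have "is_unit (const k)" using k(1) homogeneous_0_unit by simp
  ultimately show ?thesis unfolding k(2) by (simp add: mult_unit_dvd_iff')
qed

section \<open>An explicit basis of the syzygies\<close>

definition \<theta>1 :: "nat \<Rightarrow> S \<times> S \<times> S" where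
  "\<theta>1 m = (X ^ (m + 1), Y ^ (m + 1), Z ^ (m + 1))"

text \<open>The vector (x^(1-m), y^(1-m), z^(1-m)) cleared of denominators changes x^m, y^m and z^m
  at the same rate and so kills their differences; the extra factor \<open>X\<close> makes it
  tangent to x = 0.\<close>

definition \<theta>2 :: "nat \<Rightarrow> S \<times> S \<times> S" where
  "\<theta>2 m = (X * (Y ^ (m - 1) * Z ^ (m - 1)), X * (X ^ (m - 1) * Z ^ (m - 1)), X * (X ^ (m - 1) * Y ^ (m - 1)))"

text \<open>The factor by which \<open>\<theta>1 m\<close> multiplies \<open>f1 m\<close>: the line
  x = 0 contributes x^m, and a difference u^m - v^m contributes m(u^m + v^m).\<close>

definition \<alpha>1 :: "nat \<Rightarrow> S" where
  "\<alpha>1 m = X ^ m + 2 * of_nat m * (X ^ m + Y ^ m + Z ^ m)"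

definition \<alpha>2 :: "nat \<Rightarrow> S" where
  "\<alpha>2 m = Y ^ (m - 1) * Z ^ (m - 1)"

lemma vfield_f1:
  assumes "vfield \<rho> X = a * X" "vfield \<rho> (X ^ m - Y ^ m) = b * (X ^ m - Y ^ m)"
    "vfield \<rho> (Y ^ m - Z ^ m) = c * (Y ^ m - Z ^ m)" "vfield \<rho> (Z ^ m - X ^ m) = d * (Z ^ m - X ^ m)"
  shows "vfield \<rho> (f1 m) = (a + b + c + d) * f1 m"
  unfolding f1_def vfield_mult assms by (simp add: algebra_simps)

lemma vfield_E: assumes "m \<ge> 1" shows "vfield (X, Y, Z) (f1 m) = of_nat (3 * m + 1) * f1 m"
proof -
  obtain n where m: "m = Suc n" using assms by (cases m) auto
  have "vfield (X, Y, Z) (f1 m) = (1 + of_nat m + of_nat m + of_nat m) * f1 m"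
    by (rule vfield_f1) (simp_all only: vfield_diff vfield_power vfield_gens, simp_all add: m algebra_simps)
  then show ?thesis by (simp add: algebra_simps)
qed

lemma vfield_\<theta>1: assumes "m \<ge> 1" shows "vfield (\<theta>1 m) (f1 m) = \<alpha>1 m * f1 m"
proof -
  obtain n where m: "m = Suc n" using assms by (cases m) auto
  have "vfield (\<theta>1 m) (f1 m) = (X ^ m + of_nat m * (X ^ m + Y ^ m) + of_nat m * (Y ^ m + Z ^ m) + of_nat m * (Z ^ m + X ^ m)) * f1 m"
    unfolding \<theta>1_def
    by (rule vfield_f1) (simp_all only: vfield_diff vfield_power vfield_gens, simp_all add: m algebra_simps)
  also have "\<dots> = \<alpha>1 m * f1 m" by (simp add: \<alpha>1_def algebra_simps)
  finally show ?thesis .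
qed

lemma vfield_\<theta>2: assumes "m \<ge> 1" shows "vfield (\<theta>2 m) (f1 m) = \<alpha>2 m * f1 m"
proof -
  have "vfield (\<theta>2 m) (f1 m) = (\<alpha>2 m + 0 + 0 + 0) * f1 m"
    unfolding \<theta>2_def \<alpha>2_def
    by (rule vfield_f1) (simp_all only: vfield_diff vfield_power vfield_gens, simp_all add: algebra_simps)
  then show ?thesis by simp
qed

lemma det_\<theta>: assumes "m \<ge> 1" shows "det3 (X, Y, Z) (\<theta>1 m) (\<theta>2 m) = f1 m"
proof -
  obtain n where m: "m = Suc n" using assms by (cases m) auto
  show ?thesis
    by (simp add: \<theta>1_def \<theta>2_def f1_def m algebra_simps)
qed

text \<open>By Euler's identity the Euler derivation multiplies \<open>f1 m\<close> by its degree 3m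
  + 1, whence the scalar.\<close>

definition syz1 :: "nat \<Rightarrow> S \<times> S \<times> S" where
  "syz1 m = (let g = const (1 / of_nat (3 * m + 1)) * \<alpha>1 m in
     (X ^ (m + 1) - g * X, Y ^ (m + 1) - g * Y, Z ^ (m + 1) - g * Z))"

definition syz2 :: "nat \<Rightarrow> S \<times> S \<times> S" where
  "syz2 m = (let g = const (1 / of_nat (3 * m + 1)) * \<alpha>2 m in
     (X * (Y ^ (m - 1) * Z ^ (m - 1)) - g * X, X * (X ^ (m - 1) * Z ^ (m - 1)) - g * Y,
      X * (X ^ (m - 1) * Y ^ (m - 1)) - g * Z))"

text \<open>Subtracting multiples of the Euler row leaves the determinant unchanged; as it is
  nonzero, the two syzygies are independent.\<close>

lemma det_syz: assumes "m \<ge> 1" shows "det3 (X, Y, Z) (syz1 m) (syz2 m) = f1 m"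
proof -
  have "det3 (X, Y, Z) (x - g * X, y - g * Y, z - g * Z) (x' - h * X, y' - h * Y, z' - h * Z)
    = det3 (X, Y, Z) (x, y, z) (x', y', z')" for x y z x' y' z' g h
    by (simp add: algebra_simps)
  then show ?thesis
    using det_\<theta>[OF assms] unfolding syz1_def syz2_def \<theta>1_def \<theta>2_def Let_def by simp
qed

lemma of_nat_const_inverse: "n > 0 \<Longrightarrow> of_nat n * const (1 / of_nat n) = 1"
  by (rule eval_ext) simp

lemma homogeneous_of_nat: "homogeneous 0 (of_nat n)"
  using homogeneous_const[of "of_nat n"] by (simp only: const_of_nat)

lemma homogeneous_syz1: "homogeneous3 (m + 1) (syz1 m)"
proof -
  have "homogeneous (0 + m) ((2 * of_nat m) * (X ^ m + Y ^ m + Z ^ m))"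
    using homogeneous_of_nat[of "2 * m"]
    by (intro homogeneous_mult homogeneous_add homogeneous_power1 homogeneous_gens) simp_all
  then have "homogeneous m (\<alpha>1 m)"
    unfolding \<alpha>1_def by (intro homogeneous_add homogeneous_power1 homogeneous_gens) simp_all
  then have g: "homogeneous m (const t * \<alpha>1 m)" for t by (rule homogeneous_const_mult)
  have "homogeneous (m + 1) (const t * \<alpha>1 m * f)" if "homogeneous (Suc 0) f" for t f
    using homogeneous_mult[OF g that] by simp
  then show ?thesis
    unfolding syz1_def Let_def homogeneous3.simps
    by (intro conjI homogeneous_diff homogeneous_power1 homogeneous_gens) simp_all
qed

lemma homogeneous_syz2: assumes "m \<ge> 1" shows "homogeneous3 (2 * m - 1) (syz2 m)"
proof -
  have *: "homogeneous ((m - 1) + (m - 1)) (f ^ (m - 1) * g ^ (m - 1))"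
    if "homogeneous (Suc 0) f" "homogeneous (Suc 0) g" for f g
    by (intro homogeneous_mult homogeneous_power1 that)
  have g: "homogeneous ((m - 1) + (m - 1)) (const t * \<alpha>2 m)" for t
    unfolding \<alpha>2_def by (intro homogeneous_const_mult * homogeneous_gens)
  have d: "2 * m - 1 = Suc 0 + ((m - 1) + (m - 1))" using assms by simp
  have "homogeneous (2 * m - 1) (X * (f ^ (m - 1) * g ^ (m - 1)))"
    if "homogeneous (Suc 0) f" "homogeneous (Suc 0) g" for f g
    unfolding d by (intro homogeneous_mult[OF _ *[OF that]] homogeneous_gens)
  moreover have "homogeneous (2 * m - 1) (const t * \<alpha>2 m * f)" if "homogeneous (Suc 0) f" for t f
    unfolding d using homogeneous_mult[OF that g] by (simp only: mult.commute)
  ultimately show ?thesis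
    unfolding syz2_def Let_def homogeneous3.simps
    by (intro conjI homogeneous_diff) simp_all
qed

text \<open>Cramer's rule expresses \<rho> through the Euler derivation, \<open>\<theta>1 m\<close>
  and \<open>\<theta>2 m\<close> with coefficients in \<open>S\<close>, because every numerator is
  divisible by the common determinant \<open>f1 m\<close>. Annihilation of \<open>f1 m\<close> then
  fixes the Euler coefficient \<open>d0\<close> in terms of \<open>d1\<close> and \<open>d2\<close>,
  which is the correction built into the syzygies.\<close>

lemma AR_span:
  assumes m: "m \<ge> 1" and r: "\<rho> \<in> AR (f1 m)"
  shows "\<exists>u v. \<rho> = smult3 u (syz1 m) + smult3 v (syz2 m)"
proof -
  let ?E = "(X, Y, Z)" and ?f = "f1 m" and ?n = "of_nat (3 * m + 1) :: S"
  have f0: "?f \<noteq> 0" using f1_nz[OF m] .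
  obtain r1 r2 r3 where r: "\<rho> = (r1, r2, r3)" by (cases \<rho>)
  obtain s1 s2 s3 where s: "\<theta>1 m = (s1, s2, s3)" by (cases "\<theta>1 m")
  obtain t1 t2 t3 where t: "\<theta>2 m = (t1, t2, t3)" by (cases "\<theta>2 m")
  have nr: "vfield \<rho> ?f = 0" using assms(2) by (simp only: AR_iff)
  have dvd: "?f dvd vfield \<rho> ?f" "?f dvd vfield ?E ?f" "?f dvd vfield (\<theta>1 m) ?f" "?f dvd vfield (\<theta>2 m) ?f"
    using nr vfield_E[OF m] vfield_\<theta>1[OF m] vfield_\<theta>2[OF m] by simp_all
  have "?f dvd det3 \<rho> (\<theta>1 m) (\<theta>2 m)" "?f dvd det3 ?E \<rho> (\<theta>2 m)" "?f dvd det3 ?E (\<theta>1 m) \<rho>"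
    by (rule f1_dvd_det3[OF m]; use dvd in blast)+
  then obtain d0 d1 d2 where d: "det3 \<rho> (\<theta>1 m) (\<theta>2 m) = ?f * d0" "det3 ?E \<rho> (\<theta>2 m) = ?f * d1"
    "det3 ?E (\<theta>1 m) \<rho> = ?f * d2"
    by (elim dvdE) blast
  have cramer: "det3 ?E (\<theta>1 m) (\<theta>2 m) * r1 = det3 \<rho> (\<theta>1 m) (\<theta>2 m) * X + det3 ?E \<rho> (\<theta>2 m) * s1 + det3 ?E (\<theta>1 m) \<rho> * t1"
    "det3 ?E (\<theta>1 m) (\<theta>2 m) * r2 = det3 \<rho> (\<theta>1 m) (\<theta>2 m) * Y + det3 ?E \<rho> (\<theta>2 m) * s2 + det3 ?E (\<theta>1 m) \<rho> * t2"
    "det3 ?E (\<theta>1 m) (\<theta>2 m) * r3 = det3 \<rho> (\<theta>1 m) (\<theta>2 m) * Z + det3 ?E \<rho> (\<theta>2 m) * s3 + det3 ?E (\<theta>1 m) \<rho> * t3"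
    unfolding r s t by (simp_all add: algebra_simps)
  have "?f * r1 = ?f * (d0 * X + d1 * s1 + d2 * t1)" "?f * r2 = ?f * (d0 * Y + d1 * s2 + d2 * t2)"
    "?f * r3 = ?f * (d0 * Z + d1 * s3 + d2 * t3)"
    using cramer unfolding det_\<theta>[OF m] d by (simp_all add: algebra_simps)
  then have comp: "r1 = d0 * X + d1 * s1 + d2 * t1" "r2 = d0 * Y + d1 * s2 + d2 * t2" "r3 = d0 * Z + d1 * s3 + d2 * t3"
    using f0 by simp_all
  have "vfield \<rho> ?f = d0 * vfield ?E ?f + d1 * vfield (\<theta>1 m) ?f + d2 * vfield (\<theta>2 m) ?f"
    by (simp add: r s t comp algebra_simps)
  then have "(?n * d0 + \<alpha>1 m * d1 + \<alpha>2 m * d2) * ?f = 0"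
    unfolding nr vfield_E[OF m] vfield_\<theta>1[OF m] vfield_\<theta>2[OF m] by (simp add: algebra_simps)
  then have n: "?n * d0 = - (\<alpha>1 m * d1 + \<alpha>2 m * d2)"
    using f0 by (simp only: eq_neg_iff_add_eq_0 add.assoc mult_eq_0_iff simp_thms)
  let ?k = "const (1 / of_nat (3 * m + 1))"
  have "d0 = ?k * (?n * d0)"
    using of_nat_const_inverse[of "3 * m + 1"] by (simp only: mult.assoc[symmetric] mult.commute[of ?k]) simp
  then have d0: "d0 = - (?k * \<alpha>1 m * d1 + ?k * \<alpha>2 m * d2)"
    unfolding n by (simp add: algebra_simps)
  have "\<rho> = smult3 d1 (syz1 m) + smult3 d2 (syz2 m)"
    using s t unfolding r comp syz1_def syz2_def Let_def \<theta>1_def \<theta>2_def d0 by (auto simp: algebra_simps)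
  then show ?thesis by blast
qed

lemma syz_in_AR:
  assumes m: "m \<ge> 1"
  shows "syz1 m \<in> AR (f1 m)" "syz2 m \<in> AR (f1 m)"
proof -
  let ?k = "const (1 / of_nat (3 * m + 1))"
  have *: "vfield (x - g * X, y - g * Y, z - g * Z) (f1 m) = vfield (x, y, z) (f1 m) - g * vfield (X, Y, Z) (f1 m)" for x y z g
    by (simp add: algebra_simps)
  have k: "?k * a * (of_nat (3 * m + 1) * f1 m) = a * f1 m" for a
  proof -
    have "?k * a * (of_nat (3 * m + 1) * f1 m) = (of_nat (3 * m + 1) * ?k) * (a * f1 m)"
      by (simp only: mult_ac)
    moreover have "of_nat (3 * m + 1) * ?k = 1"
      by (rule of_nat_const_inverse) simp
    ultimately show ?thesis by (simp only: mult_1)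
  qed
  have "vfield (syz1 m) (f1 m) = 0"
    unfolding syz1_def Let_def * vfield_E[OF m] k using vfield_\<theta>1[OF m] by (simp add: \<theta>1_def)
  moreover have "vfield (syz2 m) (f1 m) = 0"
    unfolding syz2_def Let_def * vfield_E[OF m] k using vfield_\<theta>2[OF m] by (simp add: \<theta>2_def)
  ultimately show "syz1 m \<in> AR (f1 m)" "syz2 m \<in> AR (f1 m)"
    by (simp_all only: AR_iff)
qed

lemma syz_independent:
  assumes m: "m \<ge> 1" and z: "smult3 u (syz1 m) + smult3 v (syz2 m) = 0"
  shows "u = 0 \<and> v = 0"
proof -
  obtain a1 a2 a3 where a: "syz1 m = (a1, a2, a3)" by (cases "syz1 m")
  obtain b1 b2 b3 where b: "syz2 m = (b1, b2, b3)" by (cases "syz2 m")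
  have e: "u * a1 = - (v * b1)" "u * a2 = - (v * b2)" "u * a3 = - (v * b3)"
    using z by (auto simp: a b zero_prod_def eq_neg_iff_add_eq_0)
  have "u * det3 (X, Y, Z) (syz1 m) (syz2 m) = X * ((u * a2) * b3 - (u * a3) * b2)
    + Y * ((u * a3) * b1 - (u * a1) * b3) + Z * ((u * a1) * b2 - (u * a2) * b1)"
    by (simp add: a b algebra_simps)
  also have "\<dots> = 0" unfolding e by (simp add: algebra_simps)
  finally have "u = 0" using det_syz[OF m] f1_nz[OF m] by simp
  moreover have "v * det3 (X, Y, Z) (syz1 m) (syz2 m) = X * (a2 * (v * b3) - a3 * (v * b2))
    + Y * (a3 * (v * b1) - a1 * (v * b3)) + Z * (a1 * (v * b2) - a2 * (v * b1))"
    by (simp add: a b algebra_simps)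
  then have "v = 0" using e calculation det_syz[OF m] f1_nz[OF m] by (cases "v = 0") simp_all
  ultimately show ?thesis by simp
qed

lemma f1_free:
  assumes m: "m \<ge> 1"
  shows "free_with_exponents (f1 m) (m + 1) (2 * m - 1)"
proof -
  let ?r = "syz1 m" and ?s = "syz2 m"
  have ne: "?r \<noteq> ?s"
  proof
    assume "?r = ?s"
    then have "smult3 1 ?r + smult3 (- 1) ?s = 0"
      by (cases ?s) (simp add: zero_prod_def)
    then show False using syz_independent[OF m] by fastforce
  qed
  have "S3.independent {?r, ?s}"
    unfolding S3.dependent_finite[OF finite.insertI[OF finite.insertI[OF finite.emptyI]]]
    using syz_independent[OF m] ne by auto
  moreover have "S3.span {?r, ?s} = AR (f1 m)"
  proof
    have "S3.subspace (AR (f1 m))"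
      by (rule S3.subspaceI) (simp_all add: AR_iff vfield_zero vfield_add vfield_smult3)
    then show "S3.span {?r, ?s} \<subseteq> AR (f1 m)"
      using syz_in_AR[OF m] by (intro S3.span_minimal) auto
    show "AR (f1 m) \<subseteq> S3.span {?r, ?s}"
    proof
      fix \<rho> assume "\<rho> \<in> AR (f1 m)"
      then obtain u v where "\<rho> = smult3 u ?r + smult3 v ?s"
        using AR_span[OF m] by blast
      also have "\<dots> \<in> S3.span {?r, ?s}"
        by (intro S3.span_add S3.span_scale S3.span_base) simp_all
      finally show "\<rho> \<in> S3.span {?r, ?s}" .
    qed
  qed
  ultimately show ?thesis
    unfolding free_with_exponents_def
    using ne homogeneous_syz1 homogeneous_syz2[OF m] by blast
qed

text \<open>For m = 1 the point (1:1:1) is modular, whence the bound on m in the second conjunct.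
  The range of degrees is nonempty exactly from m = 4 on. The lower bound for all admissible degrees
  is what makes m + 2 the minimal one.\<close>

theorem proposition5p1:
  fixes m :: nat
  assumes "m \<ge> 1"
  shows "free_with_exponents (f1 m) (m + 1) (2 * m - 1)
    \<and> (m \<ge> 2 \<longrightarrow> \<not> supersolvable (A1 m))
    \<and> (m \<ge> 4 \<longrightarrow>
        (\<forall>j. m + 2 \<le> j \<and> j \<le> 2 * m - 2 \<longrightarrow> admits_unexpected_curves (dual_points (A1 m)) j)
        \<and> (\<forall>j. admits_unexpected_curves (dual_points (A1 m)) j \<longrightarrow> m + 2 \<le> j)
        \<and> generically (\<lambda>q. \<forall>F. curve_Cq (dual_points (A1 m)) (m + 2) q F \<longrightarrow> irreducible F))"
proof (intro conjI impI allI)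
  show "free_with_exponents (f1 m) (m + 1) (2 * m - 1)"
    using assms by (rule f1_free)
  show "\<not> supersolvable (A1 m)" if "m \<ge> 2"
    using that by (rule A1_not_supersolvable)
  assume "m \<ge> 4"
  then have m: "m \<ge> 3" by simp
  show "admits_unexpected_curves (dual_points (A1 m)) j" if "m + 2 \<le> j \<and> j \<le> 2 * m - 2" for j
    using admits_unexpected[OF m] that by blast
  show "m + 2 \<le> j" if "admits_unexpected_curves (dual_points (A1 m)) j" for j
    using unexpected_degree_ge[OF m that] .
  show "generically (\<lambda>q. \<forall>F. curve_Cq (dual_points (A1 m)) (m + 2) q F \<longrightarrow> irreducible F)"
    by (rule minimal_irreducible[OF m])
qed

end
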